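(* Let $X$ be a crystal 2-polygraph, and let $\mathcal P$ denote one of the following properties: termination, confluence, local confluence, confluence of critical branchings. Then $X$ has the property $\mathcal P$ if and only if the rewriting system at highest weight $\mathcal R^0(X)$ has the property $\mathcal P$.
   Context: Crystals. Fix a complex symmetrizable Kac–Moody algebra $\mathfrak g$ with weight lattice $P$, dominant weights $P^+$, simple roots $\alpha_i$ and simple coroots $\alpha_i^\vee$ ($i\in I$). A (normal) crystal is a set $\Gamma$ with maps $\mathrm{wt}:\Gamma\to P$, $\varepsilon_i,\varphi_i:\Gamma\to\mathbb Z$, $e_i,f_i:\Gamma\to\Gamma\sqcup\{0\}$ such that for all $x\in\Gamma$, $i\in I$: $\varphi_i(x)-\varepsilon_i(x)=\langle\mathrm{wt}(x),\alpha_i^\vee\rangle$; $\varepsilon_i(x)=\max\{n:e_i^n.x\ne0\}$ and $\varphi_i(x)=\max\{n:f_i^n.x\neq0\}$; $\mathrm{wt}(e_i.x)=\mathrm{wt}(x)+\alpha_i$ if $e_i.x\ne0$, and $\mathrm{wt}(f_i.x)=\mathrm{wt}(x)-\alpha_i$ if $f_i.x\neq0$; and $e_i.x=x'$ iff $f_i.x'=x$. The maps $e_i,f_i$ are the Kashiwara operators; $k$ denotes any one of them. A morphism of crystals is a map commuting with $\mathrm{wt},\varepsilon_i,\varphi_i,e_i,f_i$ (with $0\mapsto0$). "Crystal" always means a normal crystal each of whose connected components (under the Kashiwara operators) is isomorphic to the crystal $B(\lambda)$ of the irreducible highest weight module for some $\lambda\in P^+$. For a crystal $\Gamma$, $\Gamma^0$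 is the set of its highest weight elements, i.e. of $x$ with $e_i.x=0$ for all $i$; each connected component contains exactly one, and all its elements are obtained from it by applying $f_i$'s. The tensor product $\Gamma_1\otimes\Gamma_2$ is $\Gamma_1\times\Gamma_2$ with additive weight, $e_i.(u\otimes v)=(e_i.u)\otimes v$ if $\varphi_i(u)\ge\varepsilon_i(v)$ and $u\otimes(e_i.v)$ otherwise, $f_i.(u\otimes v)=(f_i.u)\otimes v$ if $\varphi_i(u)>\varepsilon_i(v)$ and $u\otimes(f_i.v)$ otherwise (a tensor with a $0$ entry is $0$). The free monoid $\Gamma^*=\bigsqcup_{n\ge0}\Gamma^{\otimes n}$ is a crystal (the empty word has weight $0$ and is killed by all operators). Polygraphs. A 2-polygraph is a pair of sets $X=(X_1,X_2)$ with source and target maps $s_1,t_1:X_2\to X_1^*$. It is a crystal 2-polygraph if $X_1,X_2$ are crystals and $s_1,t_1$ are crystal morphisms. A rewriting step is $t\alpha v:ts_1(\alpha)v\Rightarrow tt_1(\alpha)v$ with $t,v\in X_1^*$, $\alpha\in X_2$; $\mathrm{Step}(X)$ is the set of these. It is a crystal: for $\gamma=t\alpha v$, $\mathrm{wt}(\gamma)=\mathrm{wt}(ts_1(\alpha)v)$, and $k.\gamma$ is $(k.t)\alpha v$, $t(k.\alpha)v$, $t\alpha(k.v)$ or $0$ according to whether $k.(ts_1(\alpha)v)$ is $(k.t)s_1(\alpha)v$, $t(k.s_1(\alpha))v$, $ts_1(\alpha)(k.v)$ or $0$. A rewriting sequence is a (possibly infinite) sequence of composable steps; a branching is a pair of finite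 rewriting sequences with the same source, local if both entries are steps; a branching is confluent if the targets of its entries can be rewritten by finite (possibly empty) rewriting sequences to a common word. $X$ is terminating if it has no infinite rewriting sequence, (locally) confluent if all its (local) branchings are confluent. A local branching is aspherical if of the form $(f,f)$; Peiffer if (up to exchanging entries) of the form $(fv,ug)$ with $f$ a step of source $u$ and $g$ a step of source $v$; otherwise overlapping. Order local branchings by the relation generated by $(f,g)\sqsubseteq(ufv,ugv)$, $u,v\in X_1^*$; a critical branching is an overlapping local branching minimal for $\sqsubseteq$; $\mathrm{Crit}(X)$ is the set of these. Highest weight system. $\mathcal R^0(X)$ is the abstract rewriting system with set of objects $(X_1^* )^0$ and set of steps $\mathrm{Step}(X)^0$ (the highest weight elements of $\mathrm{Step}(X)$, i.e. the steps whose source is a highest weight word). A rewriting sequence of $\mathcal R^0(X)$ is a (possibly infinite) sequence of composable steps in $\mathrm{Step}(X)^0$; a branching of $\mathcal R^0(X)$ is a pair of finite rewriting sequences of $\mathcal R^0(X)$ with the same source, local if both entries are steps in $\mathrm{Step}(X)^0$; it is confluent if the targets of its entries can be rewritten by finite (possibly empty) rewriting sequences of $\mathcal R^0(X)$ to a common word of $(X_1^* )^0$. $\mathcal R^0(X)$ is terminating if it has no infinite rewriting sequence, and (locally) confluent if all its (local) branchings are confluent; its critical branchings are $\mathrm{Crit}(X)\cap\mathrm{Br}(\mathcal R^0(X))$, where $\mathrm{Br}(\mathcal R^0(X))$ is its set of branchings. *)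

theory Defs
  imports
    "HOL-Analysis.Finite_Cartesian_Product"
    "HOL-Computational_Algebra.Fraction_Field"
    "HOL-Computational_Algebra.Polynomial"
    "HOL-Library.Poly_Mapping"
begin

section \<open>Cartan data\<close>

text \<open>
  A symmetrizable Kac--Moody algebra enters only through its Cartan datum. The weight lattice
  \<open>P\<close> is a free abelian group of finite rank, written as \<open>int ^ 'r\<close> after the choice of a basis;
  its dual, in which the coroots live, is then \<open>int ^ 'r\<close> as well. The field \<open>symm\<close> holds positive
  integers \<open>d\<^sub>i = (\<alpha>\<^sub>i, \<alpha>\<^sub>i) / 2\<close> symmetrizing the Cartan matrix.
\<close>

record ('i, 'r) cartan_datum =
  root :: "'i \<Rightarrow> int ^ 'r"
  coroot :: "'i \<Rightarrow> int ^ 'r"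
  symm :: "'i \<Rightarrow> nat"

definition pairing :: "int ^ 'r \<Rightarrow> int ^ ('r::finite) \<Rightarrow> int" where
  "pairing h \<mu> = (\<Sum>k\<in>UNIV. h $ k * \<mu> $ k)"

definition cartan :: "('i, 'r::finite) cartan_datum \<Rightarrow> 'i \<Rightarrow> 'i \<Rightarrow> int" where
  "cartan D i j = pairing (coroot D i) (root D j)"

definition lin_indep_family :: "('i::finite \<Rightarrow> int ^ ('r::finite)) \<Rightarrow> bool" where
  "lin_indep_family v \<longleftrightarrow> (\<forall>c. (\<Sum>i\<in>UNIV. c i *s v i) = 0 \<longrightarrow> (\<forall>i. c i = 0))"

definition kac_moody_datum :: "('i::finite, 'r::finite) cartan_datum \<Rightarrow> bool" where
  "kac_moody_datum D \<longleftrightarrow>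
     (\<forall>i. cartan D i i = 2) \<and>
     (\<forall>i j. i \<noteq> j \<longrightarrow> cartan D i j \<le> 0) \<and>
     (\<forall>i j. cartan D i j = 0 \<longrightarrow> cartan D j i = 0) \<and>
     (\<forall>i. symm D i > 0) \<and>
     (\<forall>i j. int (symm D i) * cartan D i j = int (symm D j) * cartan D j i) \<and>
     lin_indep_family (root D) \<and> lin_indep_family (coroot D)"

definition dominant :: "('i, 'r::finite) cartan_datum \<Rightarrow> int ^ 'r \<Rightarrow> bool" where
  "dominant D \<nu> \<longleftrightarrow> (\<forall>i. pairing (coroot D i) \<nu> \<ge> 0)"


section \<open>Crystals\<close>

text \<open>The element \<open>0\<close> adjoined to a crystal is rendered by \<^term>\<open>None\<close>.\<close>

record ('i, 'r, 'x) crystal_data =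
  elts :: "'x set"
  wt :: "'x \<Rightarrow> int ^ 'r"
  eps :: "'i \<Rightarrow> 'x \<Rightarrow> int"
  phi :: "'i \<Rightarrow> 'x \<Rightarrow> int"
  ke :: "'i \<Rightarrow> 'x \<Rightarrow> 'x option"
  kf :: "'i \<Rightarrow> 'x \<Rightarrow> 'x option"

fun iter_op :: "('x \<Rightarrow> 'x option) \<Rightarrow> nat \<Rightarrow> 'x \<Rightarrow> 'x option" where
  "iter_op k 0 x = Some x"
| "iter_op k (Suc n) x = Option.bind (iter_op k n x) k"

definition is_string_length :: "('x \<Rightarrow> 'x option) \<Rightarrow> 'x \<Rightarrow> nat \<Rightarrow> bool" where
  "is_string_length k x n \<longleftrightarrow> iter_op k n x \<noteq> None \<and> (\<forall>m. iter_op k m x \<noteq> None \<longrightarrow> m \<le> n)"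

definition string_length :: "('x \<Rightarrow> 'x option) \<Rightarrow> 'x \<Rightarrow> nat" where
  "string_length k x = (GREATEST n. iter_op k n x \<noteq> None)"

definition normal_crystal ::
  "('i, 'r::finite) cartan_datum \<Rightarrow> ('i, 'r, 'x) crystal_data \<Rightarrow> bool" where
  "normal_crystal D \<Gamma> \<longleftrightarrow>
     (\<forall>i. \<forall>x\<in>elts \<Gamma>.
        phi \<Gamma> i x - eps \<Gamma> i x = pairing (coroot D i) (wt \<Gamma> x) \<and>
        (\<exists>n. eps \<Gamma> i x = int n \<and> is_string_length (ke \<Gamma> i) x n) \<and>
        (\<exists>n. phi \<Gamma> i x = int n \<and> is_string_length (kf \<Gamma> i) x n) \<and>
        (\<forall>y. ke \<Gamma> i x = Some y \<longrightarrow> y \<in> elts \<Gamma> \<and> wt \<Gamma> y = wt \<Gamma> x + root D i) \<and>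
        (\<forall>y. kf \<Gamma> i x = Some y \<longrightarrow> y \<in> elts \<Gamma> \<and> wt \<Gamma> y = wt \<Gamma> x - root D i) \<and>
        (\<forall>y\<in>elts \<Gamma>. ke \<Gamma> i x = Some y \<longleftrightarrow> kf \<Gamma> i y = Some x))"

definition crystal_morphism ::
  "('i, 'r::finite, 'x) crystal_data \<Rightarrow> ('i, 'r, 'y) crystal_data \<Rightarrow> ('x \<Rightarrow> 'y) \<Rightarrow> bool" where
  "crystal_morphism \<Gamma> \<Delta> \<psi> \<longleftrightarrow>
     (\<forall>x\<in>elts \<Gamma>. \<psi> x \<in> elts \<Delta> \<and> wt \<Delta> (\<psi> x) = wt \<Gamma> x \<and>
        (\<forall>i. eps \<Delta> i (\<psi> x) = eps \<Gamma> i x \<and> phi \<Delta> i (\<psi> x) = phi \<Gamma> i x \<and>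
             ke \<Delta> i (\<psi> x) = map_option \<psi> (ke \<Gamma> i x) \<and>
             kf \<Delta> i (\<psi> x) = map_option \<psi> (kf \<Gamma> i x)))"

definition crystal_iso :: "('i, 'r::finite, 'x) crystal_data \<Rightarrow> ('i, 'r, 'y) crystal_data \<Rightarrow> bool" where
  "crystal_iso \<Gamma> \<Delta> \<longleftrightarrow> (\<exists>\<psi>. crystal_morphism \<Gamma> \<Delta> \<psi> \<and> bij_betw \<psi> (elts \<Gamma>) (elts \<Delta>))"

definition component :: "('i, 'r::finite, 'x) crystal_data \<Rightarrow> 'x \<Rightarrow> ('i, 'r, 'x) crystal_data" where
  "component \<Gamma> x = \<Gamma>\<lparr>elts :=
     {y. (x, y) \<in> {(u, v). \<exists>i. ke \<Gamma> i u = Some v \<or> kf \<Gamma> i u = Some v}\<^sup>*}\<rparr>"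

definition highest_weight_elts :: "('i, 'r::finite, 'x) crystal_data \<Rightarrow> 'x set" where
  "highest_weight_elts \<Gamma> = {x \<in> elts \<Gamma>. \<forall>i. ke \<Gamma> i x = None}"


section \<open>Irreducible highest weight modules of the quantum group\<close>

text \<open>The quantum group is taken over \<open>\<rat>(q)\<close>.\<close>

type_synonym qfield = "rat poly fract"

definition qvar :: qfield where
  "qvar = Fract [:0, 1:] 1"

definition regular_at_0 :: "qfield set" where
  "regular_at_0 = {Fract a b | a b. poly b 0 \<noteq> 0}"

text \<open>
  Underlying spaces of modules are subspaces of a fixed space of countably infinite dimension.
  This is no restriction for highest weight modules: they are spanned by the images of the
  highest weight vector under the countably many monomials in the \<open>F\<^sub>i\<close>.
\<close>

type_synonym qvec = "nat \<Rightarrow>\<^sub>0 qfield"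

definition qscale :: "qfield \<Rightarrow> qvec \<Rightarrow> qvec" where
  "qscale c v = Poly_Mapping.map (\<lambda>x. c * x) v"

lemma lookup_qscale: "Poly_Mapping.lookup (qscale c v) n = c * Poly_Mapping.lookup v n"
  unfolding qscale_def by (simp add: map.rep_eq when_def)

global_interpretation qvec: vector_space qscale
  by standard
    (rule poly_mapping_eqI, simp add: lookup_qscale lookup_add ring_distribs mult.assoc)+

definition linear_on :: "qvec set \<Rightarrow> (qvec \<Rightarrow> qvec) \<Rightarrow> bool" where
  "linear_on V T \<longleftrightarrow> (\<forall>v\<in>V. T v \<in> V) \<and> (\<forall>u\<in>V. \<forall>v\<in>V. T (u + v) = T u + T v) \<and>
     (\<forall>c. \<forall>v\<in>V. T (qscale c v) = qscale c (T v))"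

text \<open>\<open>actK M h\<close> is the action of \<open>q\<^sup>h\<close>, for \<open>h\<close> in the dual weight lattice.\<close>

record ('i, 'r) uq_data =
  carr :: "qvec set"
  actE :: "'i \<Rightarrow> qvec \<Rightarrow> qvec"
  actF :: "'i \<Rightarrow> qvec \<Rightarrow> qvec"
  actK :: "int ^ 'r \<Rightarrow> qvec \<Rightarrow> qvec"

definition qi :: "('i, 'r::finite) cartan_datum \<Rightarrow> 'i \<Rightarrow> qfield" where
  "qi D i = qvar ^ symm D i"

definition qint :: "('i, 'r::finite) cartan_datum \<Rightarrow> 'i \<Rightarrow> nat \<Rightarrow> qfield" where
  "qint D i n = (qi D i ^ n - inverse (qi D i) ^ n) / (qi D i - inverse (qi D i))"

definition qfact :: "('i, 'r::finite) cartan_datum \<Rightarrow> 'i \<Rightarrow> nat \<Rightarrow> qfield" where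
  "qfact D i n = (\<Prod>k=1..n. qint D i k)"

definition divpow ::
  "('i, 'r::finite) cartan_datum \<Rightarrow> 'i \<Rightarrow> (qvec \<Rightarrow> qvec) \<Rightarrow> nat \<Rightarrow> qvec \<Rightarrow> qvec" where
  "divpow D i T n v = qscale (inverse (qfact D i n)) ((T ^^ n) v)"

definition serre_relation ::
  "('i, 'r::finite) cartan_datum \<Rightarrow> qvec set \<Rightarrow> ('i \<Rightarrow> qvec \<Rightarrow> qvec) \<Rightarrow> bool" where
  "serre_relation D V T \<longleftrightarrow>
     (\<forall>i j. i \<noteq> j \<longrightarrow> (\<forall>v\<in>V. let N = nat (1 - cartan D i j) in
        (\<Sum>k\<le>N. qscale ((-1) ^ k) (divpow D i (T i) k (T j (divpow D i (T i) (N - k) v)))) = 0))"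

definition uq_module ::
  "('i, 'r::finite) cartan_datum \<Rightarrow> ('i, 'r) uq_data \<Rightarrow> bool" where
  "uq_module D M \<longleftrightarrow>
     qvec.subspace (carr M) \<and>
     (\<forall>i. linear_on (carr M) (actE M i)) \<and>
     (\<forall>i. linear_on (carr M) (actF M i)) \<and>
     (\<forall>h. linear_on (carr M) (actK M h)) \<and>
     (\<forall>v\<in>carr M. actK M 0 v = v) \<and>
     (\<forall>h h'. \<forall>v\<in>carr M. actK M (h + h') v = actK M h (actK M h' v)) \<and>
     (\<forall>h i. \<forall>v\<in>carr M. actK M h (actE M i v) =
        qscale (qvar powi pairing h (root D i)) (actE M i (actK M h v))) \<and>
     (\<forall>h i. \<forall>v\<in>carr M. actK M h (actF M i v) =
        qscale (qvar powi (- pairing h (root D i))) (actF M i (actK M h v))) \<and>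
     (\<forall>i j. \<forall>v\<in>carr M. actE M i (actF M j v) - actF M j (actE M i v) =
        (if i = j
         then qscale (inverse (qi D i - inverse (qi D i)))
                (actK M (int (symm D i) *s coroot D i) v - actK M (- (int (symm D i) *s coroot D i)) v)
         else 0)) \<and>
     serre_relation D (carr M) (actE M) \<and>
     serre_relation D (carr M) (actF M)"

definition weight_space :: "('i, 'r::finite) uq_data \<Rightarrow> int ^ 'r \<Rightarrow> qvec set" where
  "weight_space M \<mu> = {v \<in> carr M. \<forall>h. actK M h v = qscale (qvar powi pairing h \<mu>) v}"

definition uq_submodule :: "('i, 'r::finite) uq_data \<Rightarrow> qvec set \<Rightarrow> bool" where
  "uq_submodule M W \<longleftrightarrow> qvec.subspace W \<and> W \<subseteq> carr M \<and>
     (\<forall>w\<in>W. (\<forall>i. actE M i w \<in> W \<and> actF M i w \<in> W) \<and> (\<forall>h. actK M h w \<in> W))"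

definition irreducible_module :: "('i, 'r::finite) uq_data \<Rightarrow> bool" where
  "irreducible_module M \<longleftrightarrow> carr M \<noteq> {0} \<and> (\<forall>W. uq_submodule M W \<longrightarrow> W = {0} \<or> W = carr M)"

definition irreducible_highest_weight_module ::
  "('i, 'r::finite) cartan_datum \<Rightarrow> int ^ 'r \<Rightarrow> ('i, 'r) uq_data \<Rightarrow> qvec \<Rightarrow> bool" where
  "irreducible_highest_weight_module D \<nu> M v \<longleftrightarrow>
     uq_module D M \<and> irreducible_module M \<and>
     v \<noteq> 0 \<and> v \<in> weight_space M \<nu> \<and> (\<forall>i. actE M i v = 0)"


section \<open>The crystal of an irreducible highest weight module\<close>

text \<open>
  A vector \<open>u\<close> of weight \<open>\<mu>\<close> of an integrable module is uniquely a finite sum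
  \<open>\<Sum>\<^sub>n F\<^sub>i\<^sup>(\<^sup>n\<^sup>) c\<^sub>n\<close>, where \<open>c\<^sub>n\<close> has weight \<open>\<mu> + n \<alpha>\<^sub>i\<close>, is killed by \<open>E\<^sub>i\<close>, and vanishes unless
  \<open>n \<le> \<langle>\<mu> + n \<alpha>\<^sub>i, \<alpha>\<^sub>i\<^sup>\<or>\<rangle>\<close>. The Kashiwara operators on vectors shift the divided powers in this sum.
  They are given here by their graphs on weight vectors.
\<close>

definition string_decomposition ::
  "('i, 'r::finite) cartan_datum \<Rightarrow> ('i, 'r) uq_data \<Rightarrow> 'i \<Rightarrow> int ^ 'r \<Rightarrow> qvec \<Rightarrow> (nat \<Rightarrow> qvec) \<Rightarrow> bool"
  where
  "string_decomposition D M i \<mu> u c \<longleftrightarrow>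
     finite {n. c n \<noteq> 0} \<and>
     (\<forall>n. c n \<in> weight_space M (\<mu> + int n *s root D i) \<and> actE M i (c n) = 0 \<and>
          (c n \<noteq> 0 \<longrightarrow> int n \<le> pairing (coroot D i) (\<mu> + int n *s root D i))) \<and>
     u = (\<Sum>n | c n \<noteq> 0. divpow D i (actF M i) n (c n))"

definition kashiwara_e ::
  "('i, 'r::finite) cartan_datum \<Rightarrow> ('i, 'r) uq_data \<Rightarrow> 'i \<Rightarrow> qvec \<Rightarrow> qvec \<Rightarrow> bool" where
  "kashiwara_e D M i u u' \<longleftrightarrow> (\<exists>\<mu> c. string_decomposition D M i \<mu> u c \<and>
     u' = (\<Sum>n | c n \<noteq> 0 \<and> n \<ge> 1. divpow D i (actF M i) (n - 1) (c n)))"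

definition kashiwara_f ::
  "('i, 'r::finite) cartan_datum \<Rightarrow> ('i, 'r) uq_data \<Rightarrow> 'i \<Rightarrow> qvec \<Rightarrow> qvec \<Rightarrow> bool" where
  "kashiwara_f D M i u u' \<longleftrightarrow> (\<exists>\<mu> c. string_decomposition D M i \<mu> u c \<and>
     u' = (\<Sum>n | c n \<noteq> 0. divpow D i (actF M i) (n + 1) (c n)))"

inductive_set kashiwara_monomials ::
  "('i, 'r::finite) cartan_datum \<Rightarrow> ('i, 'r) uq_data \<Rightarrow> qvec \<Rightarrow> qvec set"
  for D M v where
  base: "v \<in> kashiwara_monomials D M v"
| step: "w \<in> kashiwara_monomials D M v \<Longrightarrow> kashiwara_f D M i w w' \<Longrightarrow>
         w' \<in> kashiwara_monomials D M v"

text \<open>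
  The crystal lattice \<open>L(\<nu>)\<close> is spanned over the ring \<^const>\<open>regular_at_0\<close> by the monomials in
  the lowering Kashiwara operators applied to the highest weight vector, and \<open>B(\<nu>)\<close> consists of
  their nonzero residue classes in \<open>L(\<nu>) / q L(\<nu>)\<close>.
\<close>

definition crystal_lattice ::
  "('i, 'r::finite) cartan_datum \<Rightarrow> ('i, 'r) uq_data \<Rightarrow> qvec \<Rightarrow> qvec set" where
  "crystal_lattice D M v = {(\<Sum>w\<in>S. qscale (a w) w) | S a.
     finite S \<and> S \<subseteq> kashiwara_monomials D M v \<and> (\<forall>w\<in>S. a w \<in> regular_at_0)}"

definition residue_class ::
  "('i, 'r::finite) cartan_datum \<Rightarrow> ('i, 'r) uq_data \<Rightarrow> qvec \<Rightarrow> qvec \<Rightarrow> qvec set" where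
  "residue_class D M v w = {w + qscale qvar x | x. x \<in> crystal_lattice D M v}"

definition crystal_base ::
  "('i, 'r::finite) cartan_datum \<Rightarrow> ('i, 'r) uq_data \<Rightarrow> qvec \<Rightarrow> qvec set set" where
  "crystal_base D M v =
     residue_class D M v ` kashiwara_monomials D M v - {residue_class D M v 0}"

definition induced_op :: "qvec set set \<Rightarrow> (qvec \<Rightarrow> qvec \<Rightarrow> bool) \<Rightarrow> qvec set \<Rightarrow> qvec set option" where
  "induced_op B R b =
     (if \<exists>b'\<in>B. \<exists>w\<in>b. \<exists>w'\<in>b'. R w w'
      then Some (SOME b'. b' \<in> B \<and> (\<exists>w\<in>b. \<exists>w'\<in>b'. R w w')) else None)"

definition module_crystal ::
  "('i, 'r::finite) cartan_datum \<Rightarrow> ('i, 'r) uq_data \<Rightarrow> qvec \<Rightarrow> ('i, 'r, qvec set) crystal_data" where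
  "module_crystal D M v =
     (let B = crystal_base D M v;
          e = (\<lambda>i. induced_op B (kashiwara_e D M i));
          f = (\<lambda>i. induced_op B (kashiwara_f D M i))
      in \<lparr>elts = B,
          wt = (\<lambda>b. SOME \<mu>. b \<inter> weight_space M \<mu> \<noteq> {}),
          eps = (\<lambda>i b. int (string_length (e i) b)),
          phi = (\<lambda>i b. int (string_length (f i) b)),
          ke = e,
          kf = f\<rparr>)"

definition isomorphic_to_B ::
  "('i, 'r::finite) cartan_datum \<Rightarrow> int ^ 'r \<Rightarrow> ('i, 'r, 'x) crystal_data \<Rightarrow> bool" where
  "isomorphic_to_B D \<nu> \<Gamma> \<longleftrightarrow>
     (\<exists>M v. irreducible_highest_weight_module D \<nu> M v \<and> crystal_iso \<Gamma> (module_crystal D M v))"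

definition crystal :: "('i, 'r::finite) cartan_datum \<Rightarrow> ('i, 'r, 'x) crystal_data \<Rightarrow> bool" where
  "crystal D \<Gamma> \<longleftrightarrow> normal_crystal D \<Gamma> \<and>
     (\<forall>x\<in>elts \<Gamma>. \<exists>\<nu>. dominant D \<nu> \<and> isomorphic_to_B D \<nu> (component \<Gamma> x))"


section \<open>Tensor products and the crystal of words\<close>

text \<open>
  On a tensor product \<^const>\<open>eps\<close> and \<^const>\<open>phi\<close> are determined by the Kashiwara operators,
  since it is a normal crystal.
\<close>

definition tensor :: "('i, 'r::finite, 'x) crystal_data \<Rightarrow> ('i, 'r, 'y) crystal_data \<Rightarrow>
    ('i, 'r, 'x \<times> 'y) crystal_data" where
  "tensor \<Gamma> \<Delta> =
     (let e = (\<lambda>i (u, v). if phi \<Gamma> i u \<ge> eps \<Delta> i v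
                 then map_option (\<lambda>u'. (u', v)) (ke \<Gamma> i u)
                 else map_option (\<lambda>v'. (u, v')) (ke \<Delta> i v));
          f = (\<lambda>i (u, v). if phi \<Gamma> i u > eps \<Delta> i v
                 then map_option (\<lambda>u'. (u', v)) (kf \<Gamma> i u)
                 else map_option (\<lambda>v'. (u, v')) (kf \<Delta> i v))
      in \<lparr>elts = elts \<Gamma> \<times> elts \<Delta>,
          wt = (\<lambda>(u, v). wt \<Gamma> u + wt \<Delta> v),
          eps = (\<lambda>i z. int (string_length (e i) z)),
          phi = (\<lambda>i z. int (string_length (f i) z)),
          ke = e,
          kf = f\<rparr>)"

definition unit_crystal :: "('i, 'r::finite, 'x list) crystal_data" where
  "unit_crystal = \<lparr>elts = {[]}, wt = (\<lambda>_. 0), eps = (\<lambda>_ _. 0), phi = (\<lambda>_ _. 0),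
     ke = (\<lambda>_ _. None), kf = (\<lambda>_ _. None)\<rparr>"

text \<open>Transport of structure along a bijection \<open>c\<close> with inverse \<open>d\<close>.\<close>

definition relabel :: "('x \<Rightarrow> 'y) \<Rightarrow> ('y \<Rightarrow> 'x) \<Rightarrow> ('i, 'r::finite, 'x) crystal_data \<Rightarrow>
    ('i, 'r, 'y) crystal_data" where
  "relabel c d \<Gamma> = \<lparr>elts = c ` elts \<Gamma>, wt = (\<lambda>y. wt \<Gamma> (d y)),
     eps = (\<lambda>i y. eps \<Gamma> i (d y)), phi = (\<lambda>i y. phi \<Gamma> i (d y)),
     ke = (\<lambda>i y. map_option c (ke \<Gamma> i (d y))),
     kf = (\<lambda>i y. map_option c (kf \<Gamma> i (d y)))\<rparr>"

text \<open>Tensor powers are bracketed to the right; the bracketing is immaterial up to isomorphism.\<close>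

primrec tensor_power :: "('i, 'r::finite, 'x) crystal_data \<Rightarrow> nat \<Rightarrow> ('i, 'r, 'x list) crystal_data"
  where
  "tensor_power \<Gamma> 0 = unit_crystal"
| "tensor_power \<Gamma> (Suc n) =
     relabel (\<lambda>(x, w). x # w) (\<lambda>w. (hd w, tl w)) (tensor \<Gamma> (tensor_power \<Gamma> n))"

definition words :: "('i, 'r::finite, 'x) crystal_data \<Rightarrow> ('i, 'r, 'x list) crystal_data" where
  "words \<Gamma> = \<lparr>elts = (\<Union>n. elts (tensor_power \<Gamma> n)),
     wt = (\<lambda>w. wt (tensor_power \<Gamma> (length w)) w),
     eps = (\<lambda>i w. eps (tensor_power \<Gamma> (length w)) i w),
     phi = (\<lambda>i w. phi (tensor_power \<Gamma> (length w)) i w),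
     ke = (\<lambda>i w. ke (tensor_power \<Gamma> (length w)) i w),
     kf = (\<lambda>i w. kf (tensor_power \<Gamma> (length w)) i w)\<rparr>"


section \<open>Abstract rewriting systems\<close>

record ('o, 's) rewriting_system =
  objs :: "'o set"
  steps :: "'s set"
  source :: "'s \<Rightarrow> 'o"
  target :: "'s \<Rightarrow> 'o"

text \<open>
  A finite rewriting sequence is encoded as its source together with the list of its steps,
  so that there is an empty sequence at each object.
\<close>

fun is_sequence :: "('o, 's) rewriting_system \<Rightarrow> 'o \<Rightarrow> 's list \<Rightarrow> bool" where
  "is_sequence A x [] \<longleftrightarrow> x \<in> objs A"
| "is_sequence A x (s # ss) \<longleftrightarrow>
     x \<in> objs A \<and> s \<in> steps A \<and> source A s = x \<and> is_sequence A (target A s) ss"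

definition finite_sequences :: "('o, 's) rewriting_system \<Rightarrow> ('o \<times> 's list) set" where
  "finite_sequences A = {(x, ss). is_sequence A x ss}"

fun seq_target :: "('o, 's) rewriting_system \<Rightarrow> 'o \<times> 's list \<Rightarrow> 'o" where
  "seq_target A (x, ss) = (if ss = [] then x else target A (last ss))"

definition branchings ::
  "('o, 's) rewriting_system \<Rightarrow> (('o \<times> 's list) \<times> ('o \<times> 's list)) set" where
  "branchings A = {(p, p'). p \<in> finite_sequences A \<and> p' \<in> finite_sequences A \<and> fst p = fst p'}"

definition local_branchings :: "('o, 's) rewriting_system \<Rightarrow> ('s \<times> 's) set" where
  "local_branchings A = {(f, g). f \<in> steps A \<and> g \<in> steps A \<and> source A f = source A g}"

text \<open>A pair of steps, viewed as a pair of sequences of length one.\<close>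

fun as_branching ::
  "('o, 's) rewriting_system \<Rightarrow> 's \<times> 's \<Rightarrow> ('o \<times> 's list) \<times> ('o \<times> 's list)" where
  "as_branching A (f, g) = ((source A f, [f]), (source A g, [g]))"

definition confluent_branching ::
  "('o, 's) rewriting_system \<Rightarrow> ('o \<times> 's list) \<times> ('o \<times> 's list) \<Rightarrow> bool" where
  "confluent_branching A b \<longleftrightarrow> (\<exists>r\<in>finite_sequences A. \<exists>r'\<in>finite_sequences A.
     fst r = seq_target A (fst b) \<and> fst r' = seq_target A (snd b) \<and>
     seq_target A r = seq_target A r')"

definition terminating :: "('o, 's) rewriting_system \<Rightarrow> bool" where
  "terminating A \<longleftrightarrow>
     \<not> (\<exists>\<sigma> :: nat \<Rightarrow> 's. \<forall>n. \<sigma> n \<in> steps A \<and> target A (\<sigma> n) = source A (\<sigma> (Suc n)))"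

definition confluent :: "('o, 's) rewriting_system \<Rightarrow> bool" where
  "confluent A \<longleftrightarrow> (\<forall>b\<in>branchings A. confluent_branching A b)"

definition locally_confluent :: "('o, 's) rewriting_system \<Rightarrow> bool" where
  "locally_confluent A \<longleftrightarrow> (\<forall>b\<in>local_branchings A. confluent_branching A (as_branching A b))"


section \<open>Crystal 2-polygraphs\<close>

record ('i, 'r, 'a, 'b) polygraph =
  gen1 :: "('i, 'r, 'a) crystal_data"
  gen2 :: "('i, 'r, 'b) crystal_data"
  src1 :: "'b \<Rightarrow> 'a list"
  tgt1 :: "'b \<Rightarrow> 'a list"

definition crystal_2_polygraph ::
  "('i, 'r::finite) cartan_datum \<Rightarrow> ('i, 'r, 'a, 'b) polygraph \<Rightarrow> bool" where
  "crystal_2_polygraph D X \<longleftrightarrow>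
     crystal D (gen1 X) \<and> crystal D (gen2 X) \<and>
     crystal_morphism (gen2 X) (words (gen1 X)) (src1 X) \<and>
     crystal_morphism (gen2 X) (words (gen1 X)) (tgt1 X)"

text \<open>The triple \<open>(t, \<alpha>, v)\<close> stands for the step \<open>t \<alpha> v\<close>.\<close>

type_synonym ('a, 'b) step = "'a list \<times> 'b \<times> 'a list"

fun step_source :: "('i, 'r::finite, 'a, 'b) polygraph \<Rightarrow> ('a, 'b) step \<Rightarrow> 'a list" where
  "step_source X (t, \<alpha>, v) = t @ src1 X \<alpha> @ v"

fun step_target :: "('i, 'r::finite, 'a, 'b) polygraph \<Rightarrow> ('a, 'b) step \<Rightarrow> 'a list" where
  "step_target X (t, \<alpha>, v) = t @ tgt1 X \<alpha> @ v"

definition Step :: "('i, 'r::finite, 'a, 'b) polygraph \<Rightarrow> ('a, 'b) step set" where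
  "Step X = elts (words (gen1 X)) \<times> elts (gen2 X) \<times> elts (words (gen1 X))"

text \<open>
  The operator on steps determined by an operator \<open>k\<close> on words, an operator \<open>k2\<close> on 2-cells
  and the source map \<open>s\<close>.
\<close>

fun step_op :: "('a list \<Rightarrow> 'a list option) \<Rightarrow> ('b \<Rightarrow> 'b option) \<Rightarrow> ('b \<Rightarrow> 'a list) \<Rightarrow>
    ('a, 'b) step \<Rightarrow> ('a, 'b) step option" where
  "step_op k k2 s (t, \<alpha>, v) =
     (case k (t @ s \<alpha> @ v) of
        None \<Rightarrow> None
      | Some w \<Rightarrow>
          if k t \<noteq> None \<and> w = the (k t) @ s \<alpha> @ v then Some (the (k t), \<alpha>, v)
          else if k (s \<alpha>) \<noteq> None \<and> w = t @ the (k (s \<alpha>)) @ v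
            then map_option (\<lambda>\<alpha>'. (t, \<alpha>', v)) (k2 \<alpha>)
          else if k v \<noteq> None \<and> w = t @ s \<alpha> @ the (k v) then Some (t, \<alpha>, the (k v))
          else None)"

definition step_crystal ::
  "('i, 'r::finite, 'a, 'b) polygraph \<Rightarrow> ('i, 'r, ('a, 'b) step) crystal_data" where
  "step_crystal X =
     (let e = (\<lambda>i. step_op (ke (words (gen1 X)) i) (ke (gen2 X) i) (src1 X));
          f = (\<lambda>i. step_op (kf (words (gen1 X)) i) (kf (gen2 X) i) (src1 X))
      in \<lparr>elts = Step X,
          wt = (\<lambda>\<gamma>. wt (words (gen1 X)) (step_source X \<gamma>)),
          eps = (\<lambda>i \<gamma>. int (string_length (e i) \<gamma>)),
          phi = (\<lambda>i \<gamma>. int (string_length (f i) \<gamma>)),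
          ke = e,
          kf = f\<rparr>)"

definition rewriting :: "('i, 'r::finite, 'a, 'b) polygraph \<Rightarrow>
    ('a list, ('a, 'b) step) rewriting_system" where
  "rewriting X = \<lparr>objs = elts (words (gen1 X)), steps = Step X,
     source = step_source X, target = step_target X\<rparr>"

definition hw_rewriting :: "('i, 'r::finite, 'a, 'b) polygraph \<Rightarrow>
    ('a list, ('a, 'b) step) rewriting_system" where
  "hw_rewriting X = \<lparr>objs = highest_weight_elts (words (gen1 X)),
     steps = highest_weight_elts (step_crystal X),
     source = step_source X, target = step_target X\<rparr>"

fun whisker :: "'a list \<Rightarrow> ('a, 'b) step \<Rightarrow> 'a list \<Rightarrow> ('a, 'b) step" where
  "whisker u (t, \<alpha>, v) w = (u @ t, \<alpha>, v @ w)"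

definition aspherical :: "('a, 'b) step \<times> ('a, 'b) step \<Rightarrow> bool" where
  "aspherical b \<longleftrightarrow> (\<exists>f. b = (f, f))"

definition peiffer ::
  "('i, 'r::finite, 'a, 'b) polygraph \<Rightarrow> ('a, 'b) step \<times> ('a, 'b) step \<Rightarrow> bool" where
  "peiffer X b \<longleftrightarrow> (\<exists>f\<in>Step X. \<exists>g\<in>Step X.
     let fv = whisker [] f (step_source X g); ug = whisker (step_source X f) g []
     in b = (fv, ug) \<or> b = (ug, fv))"

definition overlapping ::
  "('i, 'r::finite, 'a, 'b) polygraph \<Rightarrow> ('a, 'b) step \<times> ('a, 'b) step \<Rightarrow> bool" where
  "overlapping X b \<longleftrightarrow> \<not> aspherical b \<and> \<not> peiffer X b"

definition branching_le :: "('i, 'r::finite, 'a, 'b) polygraph \<Rightarrow>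
    ('a, 'b) step \<times> ('a, 'b) step \<Rightarrow> ('a, 'b) step \<times> ('a, 'b) step \<Rightarrow> bool" where
  "branching_le X b b' \<longleftrightarrow>
     (\<exists>u\<in>elts (words (gen1 X)). \<exists>v\<in>elts (words (gen1 X)).
        b' = (whisker u (fst b) v, whisker u (snd b) v))"

definition Crit :: "('i, 'r::finite, 'a, 'b) polygraph \<Rightarrow>
    (('a, 'b) step \<times> ('a, 'b) step) set" where
  "Crit X = {b \<in> local_branchings (rewriting X). overlapping X b \<and>
     (\<forall>b'\<in>local_branchings (rewriting X). branching_le X b' b \<longrightarrow> b' = b)}"

definition hw_Crit :: "('i, 'r::finite, 'a, 'b) polygraph \<Rightarrow>
    (('a, 'b) step \<times> ('a, 'b) step) set" where
  "hw_Crit X = {b \<in> Crit X. as_branching (hw_rewriting X) b \<in> branchings (hw_rewriting X)}"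

definition critically_confluent :: "('i, 'r::finite, 'a, 'b) polygraph \<Rightarrow> bool" where
  "critically_confluent X \<longleftrightarrow>
     (\<forall>b\<in>Crit X. confluent_branching (rewriting X) (as_branching (rewriting X) b))"

definition hw_critically_confluent :: "('i, 'r::finite, 'a, 'b) polygraph \<Rightarrow> bool" where
  "hw_critically_confluent X \<longleftrightarrow>
     (\<forall>b\<in>hw_Crit X. confluent_branching (hw_rewriting X) (as_branching (hw_rewriting X) b))"

end

theory Submission
  imports Defs
begin

text \<open>
  A Kashiwara operator acts on a step \<open>t \<alpha> v\<close> through the tensor product rule, and source and target
  commute with it, since those of 2-cells are crystal morphisms. Hence each Kashiwara operator which
  is defined on a word transports all rewriting sequences starting at that word, and is undone by
  the opposite operator; it also preserves Peiffer, overlapping and critical branchings. Raising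
  operators lead from every word to a highest weight word in finitely many steps: on a component
  \<open>B(\<nu>)\<close> the weights lie in \<open>\<nu> - \<Sum>\<^sub>i \<nat> \<alpha>\<^sub>i\<close>, so chains of raising operators from a letter are
  bounded, and the sum of these bounds over the letters of a word decreases under raising. Each
  property at a word is therefore equivalent to the property at a highest weight word, from which
  all rewriting steps are of highest weight.
\<close>

section \<open>Raising operators and weights\<close>

text \<open>The obstacle is that a component is known only through an isomorphism with a set of
  residue classes of module vectors; that raising stops has to be extracted from the module. Each
  class contains a nonzero weight vector of the weight assigned to it, so it suffices to bound the
  weights of the module itself. There irreducibility makes the ordinary monomials in the
  \<open>actF\<close> span, and eigenvectors of the \<open>actK\<close> with distinct characters are
  independent because q is not a root of unity. Linear independence of the simple roots then turns
  the bound on weights into a bound on the number of raisings. On the combinatorial side,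
  \<open>step_op\<close> locates the affected factor by comparing words. Identifying it with the
  operator of a tensor product reduces everything about steps to inequalities between
  \<open>phi\<close> and \<open>eps\<close>, and a change of bracketing then describes steps inside
  a context. Criticality is the delicate property: minimality of a transported branching is verified
  by transporting its decompositions back with the opposite operator, which preserves the lengths of
  the contexts.\<close>

lemma qvar_power: "qvar ^ n = Fract (monom 1 n) 1"
proof (induction n)
  case 0
  show ?case by (simp add: One_fract_def)
next
  case (Suc n)
  have "monom 1 (Suc n) = ([:0, 1:] :: rat poly) * monom 1 n"
    by (simp add: monom_Suc)
  then show ?case using Suc by (simp add: qvar_def)
qed

lemma qvar_nonzero: "qvar \<noteq> 0"
  by (simp add: qvar_def Zero_fract_def eq_fract)

lemma qvar_power_eq_1_iff: "qvar ^ n = 1 \<longleftrightarrow> n = 0"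
proof
  assume "qvar ^ n = 1"
  then have "monom 1 n = (1 :: rat poly)"
    by (simp add: qvar_power One_fract_def eq_fract)
  then show "n = 0"
    by (metis degree_1 degree_monom_eq zero_neq_one)
qed simp

text \<open>Since q has infinite order, the scalars by which the \<open>actK M h\<close> act recover
  the integers \<open>pairing h \<mu>\<close>; this is what separates weight spaces below.\<close>

lemma qvar_powi_inject: "qvar powi a = qvar powi b \<longleftrightarrow> a = b"
proof -
  have *: "a = b" if "a \<le> b" "qvar powi a = qvar powi b" for a b
  proof -
    have "qvar powi (b - a) = 1"
      using that qvar_nonzero by (simp add: power_int_diff)
    then have "qvar ^ nat (b - a) = 1"
      using that(1) by (simp add: power_int_def)
    then show ?thesis
      using that(1) qvar_power_eq_1_iff[of "nat (b - a)"] by simp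
  qed
  show ?thesis
    using *[of a b] *[of b a] by (metis linear)
qed

lemma pairing_diff: "pairing h (x - y) = pairing h x - pairing h y"
  by (simp add: pairing_def algebra_simps sum_subtractf)

lemma pairing_separates:
  assumes "\<mu> \<noteq> \<sigma>"
  obtains h where "pairing h \<mu> \<noteq> pairing h \<sigma>"
proof -
  obtain k where k: "\<mu> $ k \<noteq> \<sigma> $ k" using assms by (auto simp: vec_eq_iff)
  have "pairing (axis k 1) \<rho> = \<rho> $ k" for \<rho>
    by (simp add: pairing_def axis_def if_distrib[of "\<lambda>x. x * _"] cong: if_cong)
  then show ?thesis using k that by metis
qed

text \<open>The usual root order, with \<nu> the larger weight. The coefficients are kept as a
  function on the index set so that they can later be compared by linear independence of the
  roots.\<close>

definition below :: "('i::finite, 'r::finite) cartan_datum \<Rightarrow> int ^ 'r \<Rightarrow> int ^ 'r \<Rightarrow> bool" where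
  "below D \<nu> \<mu> \<longleftrightarrow> (\<exists>n :: 'i \<Rightarrow> nat. \<mu> = \<nu> - (\<Sum>i\<in>UNIV. int (n i) *s root D i))"

lemma sum_fun_upd_Suc:
  fixes r :: "'i::finite \<Rightarrow> int ^ 'r::finite"
  shows "(\<Sum>i\<in>UNIV. int ((n(j := Suc (n j))) i) *s r i) = (\<Sum>i\<in>UNIV. int (n i) *s r i) + r j"
proof -
  have "(\<Sum>i\<in>UNIV. int ((n(j := Suc (n j))) i) *s r i) =
      (\<Sum>i\<in>UNIV. int (n i) *s r i + (if i = j then r i else 0))"
    by (rule sum.cong) (auto simp: vec_eq_iff algebra_simps)
  then show ?thesis by (simp add: sum.distrib)
qed

lemma below_refl: "below D \<nu> \<nu>"
  unfolding below_def by (rule exI[of _ "\<lambda>_. 0"]) simp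

lemma below_minus_root: "below D \<nu> \<mu> \<Longrightarrow> below D \<nu> (\<mu> - root D j)"
  unfolding below_def by (elim exE, rule_tac x = "n(j := Suc (n j))" in exI)
    (simp only: sum_fun_upd_Suc, simp)

section \<open>Weights of an irreducible highest weight module\<close>

lemma linear_on_zero: "linear_on V T \<Longrightarrow> qvec.subspace V \<Longrightarrow> T 0 = 0"
  unfolding linear_on_def by (metis qvec.scale_zero_left qvec.subspace_0)

lemma linear_on_span:
  assumes "linear_on V T" "qvec.subspace V" "S \<subseteq> V" "\<And>x. x \<in> S \<Longrightarrow> T x \<in> qvec.span R"
    and "x \<in> qvec.span S"
  shows "T x \<in> qvec.span R"
proof -
  \<comment> \<open>Linearity is available only on \<open>V\<close>, so membership in
    \<open>V\<close> has to be carried through the induction.\<close>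
  have "x \<in> V \<and> T x \<in> qvec.span R"
    using assms(5)
  proof (induction rule: qvec.span_induct_alt)
    case base
    show ?case
      using linear_on_zero[OF assms(1,2)] qvec.subspace_0[OF assms(2)] qvec.span_zero by simp
  next
    case (step c x y)
    have x: "x \<in> V" using step(1) assms(3) by auto
    have "T (qscale c x + y) = qscale c (T x) + T y"
      using assms(1,2) x step(2) qvec.subspace_scale by (auto simp: linear_on_def)
    then show ?case
      using step assms(2,4) x
      by (auto intro!: qvec.subspace_add qvec.subspace_scale qvec.span_add qvec.span_scale)
  qed
  then show ?thesis ..
qed

text \<open>Monomials in the plain operators \<open>actF\<close>, as opposed to
  \<open>kashiwara_monomials\<close>: these span the module over the field, while the latter
  generate the lattice.\<close>

inductive_set F_monomials :: "('i, 'r::finite) uq_data \<Rightarrow> qvec \<Rightarrow> qvec set" for M v where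
  base: "v \<in> F_monomials M v"
| step: "w \<in> F_monomials M v \<Longrightarrow> actF M j w \<in> F_monomials M v"

lemma weight_space_F:
  assumes "uq_module D M" "x \<in> weight_space M \<mu>"
  shows "actF M j x \<in> weight_space M (\<mu> - root D j)"
proof -
  have x: "x \<in> carr M" "\<And>h. actK M h x = qscale (qvar powi pairing h \<mu>) x"
    using assms(2) by (auto simp: weight_space_def)
  have lin: "linear_on (carr M) (actF M j)" using assms(1) by (auto simp: uq_module_def)
  have "actK M h (actF M j x) = qscale (qvar powi (- pairing h (root D j))) (actF M j (actK M h x))" for h
    using assms(1) x(1) by (auto simp: uq_module_def)
  also have "\<dots> h = qscale (qvar powi pairing h (\<mu> - root D j)) (actF M j x)" for h
    using lin x qvar_nonzero
    by (simp add: linear_on_def pairing_diff power_int_diff power_int_minus field_simps)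
  finally show ?thesis
    using lin x(1) by (auto simp: weight_space_def linear_on_def)
qed

lemma weight_space_subspace:
  assumes "uq_module D M"
  shows "qvec.subspace (weight_space M \<mu>)"
proof (rule qvec.subspaceI)
  have sub: "qvec.subspace (carr M)" and lin: "\<And>h. linear_on (carr M) (actK M h)"
    using assms by (auto simp: uq_module_def)
  show "0 \<in> weight_space M \<mu>"
    using linear_on_zero[OF lin sub] qvec.subspace_0[OF sub] by (auto simp: weight_space_def)
  show "x + y \<in> weight_space M \<mu>" if "x \<in> weight_space M \<mu>" "y \<in> weight_space M \<mu>" for x y
    using that lin qvec.subspace_add[OF sub]
    by (auto simp: weight_space_def linear_on_def qvec.scale_right_distrib)
  show "qscale c x \<in> weight_space M \<mu>" if "x \<in> weight_space M \<mu>" for x c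
    using that lin qvec.subspace_scale[OF sub]
    by (auto simp: weight_space_def linear_on_def mult.commute)
qed

text \<open>The span of the monomials is a submodule containing the nonzero vector \<open>v\<close>,
  so irreducibility makes it everything. Stability under \<open>actF\<close> and \<open>actK\<close>
  is immediate; for \<open>actE\<close> the commutation relation with \<open>actF\<close> is
  used.\<close>

lemma carr_eq_span_F_monomials:
  assumes "irreducible_highest_weight_module D \<nu> M v"
  shows "carr M = qvec.span (F_monomials M v)"
proof -
  have uq: "uq_module D M" and irr: "irreducible_module M" and "v \<noteq> 0"
    and v: "v \<in> weight_space M \<nu>" and Ev: "\<And>i. actE M i v = 0"
    using assms by (auto simp: irreducible_highest_weight_module_def)
  let ?W = "qvec.span (F_monomials M v)"
  have sub: "qvec.subspace (carr M)"
    and linE: "\<And>i. linear_on (carr M) (actE M i)"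
    and linF: "\<And>i. linear_on (carr M) (actF M i)"
    and linK: "\<And>h. linear_on (carr M) (actK M h)"
    using uq by (auto simp: uq_module_def)
  have comm: "actE M i (actF M j x) = actF M j (actE M i x) + (if i = j
         then qscale (inverse (qi D i - inverse (qi D i)))
                (actK M (int (symm D i) *s coroot D i) x - actK M (- (int (symm D i) *s coroot D i)) x)
         else 0)" if "x \<in> carr M" for i j x
  proof -
    have "actE M i (actF M j x) - actF M j (actE M i x) = (if i = j
         then qscale (inverse (qi D i - inverse (qi D i)))
                (actK M (int (symm D i) *s coroot D i) x - actK M (- (int (symm D i) *s coroot D i)) x)
         else 0)"
      using uq that unfolding uq_module_def by blast
    then show ?thesis by (simp only: diff_eq_eq add.commute[of "actF M j (actE M i x)"])
  qed
  have wt: "\<exists>\<mu>. w \<in> weight_space M \<mu>" if "w \<in> F_monomials M v" for w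
    using that by induction (use v weight_space_F[OF uq] in blast)+
  have carr: "F_monomials M v \<subseteq> carr M"
    using wt by (auto simp: weight_space_def)
  have F: "actF M j x \<in> ?W" if "x \<in> ?W" for j x
    by (rule linear_on_span[OF linF sub carr _ that]) (blast intro: qvec.span_base F_monomials.step)
  have Kmon: "actK M h w \<in> ?W" if "w \<in> F_monomials M v" for h w
    using wt[OF that] qvec.span_scale[OF qvec.span_base[OF that]] by (auto simp: weight_space_def)
  have K: "actK M h x \<in> ?W" if "x \<in> ?W" for h x
    using linear_on_span[OF linK sub carr Kmon that] .
  \<comment> \<open>\<open>actE\<close> is moved past the outermost \<open>actF\<close>. The
    commutator contributes only multiples of \<open>actK\<close> applied to the shorter monomial,
    and at the end \<open>actE\<close> kills \<open>v\<close>.\<close>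
  have Emon: "actE M i w \<in> ?W" if "w \<in> F_monomials M v" for i w
    using that
  proof induction
    case base
    show ?case by (simp add: Ev qvec.span_zero)
  next
    case (step w j)
    then have "w \<in> carr M" using carr by auto
    then show ?case
      using step F Kmon
      by (auto simp: comm intro!: qvec.span_add qvec.span_scale qvec.span_diff qvec.span_zero)
  qed
  have E: "actE M i x \<in> ?W" if "x \<in> ?W" for i x
    using linear_on_span[OF linE sub carr Emon that] .
  have "uq_submodule M ?W"
    using E F K qvec.span_minimal[OF carr sub] by (auto simp: uq_submodule_def qvec.subspace_span)
  moreover have "v \<in> ?W" by (simp add: F_monomials.base qvec.span_base)
  ultimately show ?thesis
    using irr \<open>v \<noteq> 0\<close> by (auto simp: irreducible_module_def)
qed

lemma F_monomials_weight:
  assumes "uq_module D M" "v \<in> weight_space M \<nu>" "w \<in> F_monomials M v"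
  shows "\<exists>\<mu>. below D \<nu> \<mu> \<and> w \<in> weight_space M \<mu>"
  using assms(3)
  by induction (use assms(2) weight_space_F[OF assms(1)] below_refl below_minus_root in blast)+

text \<open>Applying \<open>q\<^sup>h - q\<^sup>\<langle>\<^sup>h\<^sup>,\<^sup>\<sigma>\<^sup>\<rangle>\<close> removes one summand of weight \<open>\<sigma>\<close> and rescales the others.\<close>

lemma weight_spaces_independent:
  assumes uq: "uq_module D M"
  shows "x \<in> weight_space M \<mu> \<Longrightarrow> x = sum_list ys \<Longrightarrow>
    (\<forall>y\<in>set ys. \<exists>\<sigma>. \<sigma> \<noteq> \<mu> \<and> y \<in> weight_space M \<sigma>) \<Longrightarrow> x = 0"
\<comment> \<open>The summands form a list, not a set, because several of them may share a weight or
  become equal after \<open>T\<close> is applied.\<close>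
proof (induction "length ys" arbitrary: x ys)
  case 0
  then show ?case by simp
next
  case (Suc n)
  have lin: "linear_on (carr M) (actK M h)" for h using uq by (auto simp: uq_module_def)
  have sub: "qvec.subspace (carr M)" using uq by (auto simp: uq_module_def)
  obtain y zs where ys: "ys = y # zs" "length zs = n" using Suc(2) by (cases ys) auto
  obtain \<sigma> where \<sigma>: "\<sigma> \<noteq> \<mu>" "y \<in> weight_space M \<sigma>" using Suc(5) ys by auto
  obtain h where h: "pairing h \<mu> \<noteq> pairing h \<sigma>" using pairing_separates \<sigma>(1) by metis
  define c where "c = qvar powi pairing h \<sigma>"
  define T where "T = (\<lambda>z. actK M h z - qscale c z)"
  have T_add: "T (a + b) = T a + T b" if "a \<in> carr M" "b \<in> carr M" for a b
    using that lin[of h] by (simp add: T_def linear_on_def qvec.scale_right_distrib)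
  have T_weight: "T z = qscale (qvar powi pairing h \<rho> - c) z" if "z \<in> weight_space M \<rho>" for z \<rho>
    using that by (simp add: T_def weight_space_def qvec.scale_left_diff_distrib)
  have T_sum: "sum_list zs \<in> carr M \<and> T (sum_list zs) = sum_list (map T zs)" if "set zs \<subseteq> carr M" for zs
    using that
  proof (induction zs)
    case Nil
    have "T 0 = T (0 + 0)" by simp
    then have "T 0 = T 0 + T 0" using T_add qvec.subspace_0[OF sub] by metis
    then show ?case using qvec.subspace_0[OF sub] by simp
  next
    case (Cons a zs)
    then show ?case using T_add qvec.subspace_add[OF sub] by auto
  qed
  have carr: "set ys \<subseteq> carr M" using Suc(5) by (auto simp: weight_space_def)
  have "T x = T y + T (sum_list zs)"
    using Suc(4) ys carr T_add T_sum by auto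
  also have "T y = 0" using T_weight[OF \<sigma>(2)] by (simp add: c_def)
  finally have *: "T x = sum_list (map T zs)" using T_sum carr ys by auto
  have "T x = 0"
  proof (rule Suc(1)[OF _ _ *])
    show "n = length (map T zs)" using ys by simp
    show "T x \<in> weight_space M \<mu>"
      using T_weight[OF Suc(3)] Suc(3) qvec.subspace_scale[OF weight_space_subspace[OF uq]] by simp
    show "\<forall>y\<in>set (map T zs). \<exists>\<sigma>. \<sigma> \<noteq> \<mu> \<and> y \<in> weight_space M \<sigma>"
    proof
      fix y assume "y \<in> set (map T zs)"
      then obtain z where z: "z \<in> set zs" "y = T z" by auto
      then obtain \<rho> where \<rho>: "\<rho> \<noteq> \<mu>" "z \<in> weight_space M \<rho>" using Suc(5) ys by auto
      then show "\<exists>\<sigma>. \<sigma> \<noteq> \<mu> \<and> y \<in> weight_space M \<sigma>"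
        using z T_weight qvec.subspace_scale[OF weight_space_subspace[OF uq]] by metis
    qed
  qed
  \<comment> \<open>The scalar is nonzero by the choice of \<open>h\<close>, so \<open>x\<close>
    itself vanishes.\<close>
  then have "qscale (qvar powi pairing h \<mu> - c) x = 0" using T_weight[OF Suc(3)] by simp
  then show ?case using h by (simp add: c_def qvar_powi_inject)
qed

text \<open>All spanning monomials have weights below \<nu>. If \<mu> were not below \<nu>, a vector
  of weight \<mu> would be a sum of vectors of other weights, hence zero.\<close>

lemma weight_below:
  assumes "irreducible_highest_weight_module D \<nu> M v" "x \<in> weight_space M \<mu>" "x \<noteq> 0"
  shows "below D \<nu> \<mu>"
proof (rule ccontr)
  assume not: "\<not> below D \<nu> \<mu>"
  have uq: "uq_module D M" and v: "v \<in> weight_space M \<nu>"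
    using assms(1) by (auto simp: irreducible_highest_weight_module_def)
  have "x \<in> qvec.span (F_monomials M v)"
    using assms(2) carr_eq_span_F_monomials[OF assms(1)] by (auto simp: weight_space_def)
  then have "\<exists>ys. x = sum_list ys \<and> (\<forall>y\<in>set ys. \<exists>\<sigma>. \<sigma> \<noteq> \<mu> \<and> y \<in> weight_space M \<sigma>)"
  proof (induction rule: qvec.span_induct_alt)
    case base
    show ?case by (rule exI[of _ "[]"]) simp
  next
    case (step c w y)
    obtain \<sigma> where "below D \<nu> \<sigma>" "w \<in> weight_space M \<sigma>"
      using F_monomials_weight[OF uq v step(1)] by auto
    then have "\<sigma> \<noteq> \<mu> \<and> qscale c w \<in> weight_space M \<sigma>"
      using not qvec.subspace_scale[OF weight_space_subspace[OF uq]] by auto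
    moreover obtain ys where "y = sum_list ys" "\<forall>y\<in>set ys. \<exists>\<sigma>. \<sigma> \<noteq> \<mu> \<and> y \<in> weight_space M \<sigma>"
      using step(2) by auto
    ultimately show ?case by (intro exI[of _ "qscale c w # ys"]) auto
  qed
  then show False using weight_spaces_independent[OF uq assms(2)] assms(3) by blast
qed

section \<open>The crystal lattice and the weights of residue classes\<close>

lemma regular_at_0_add: "a \<in> regular_at_0 \<Longrightarrow> b \<in> regular_at_0 \<Longrightarrow> a + b \<in> regular_at_0"
  unfolding regular_at_0_def mem_Collect_eq
proof (elim exE conjE)
  fix p q r s assume *: "a = Fract p q" "poly q 0 \<noteq> 0" "b = Fract r s" "poly s 0 \<noteq> 0"
  then have "q \<noteq> 0" "s \<noteq> 0" by auto
  then have "a + b = Fract (p * s + r * q) (q * s)" using * by simp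
  moreover have "poly (q * s) 0 \<noteq> 0" using * by simp
  ultimately show "\<exists>p q. a + b = Fract p q \<and> poly q 0 \<noteq> 0" by blast
qed

lemma regular_at_0_uminus: "a \<in> regular_at_0 \<Longrightarrow> - a \<in> regular_at_0"
  unfolding regular_at_0_def mem_Collect_eq by (elim exE conjE) (metis minus_fract)

lemma zero_regular_at_0: "0 \<in> regular_at_0"
  unfolding regular_at_0_def Zero_fract_def
  by (rule CollectI, rule exI[of _ 0], rule exI[of _ 1]) simp

lemma crystal_lattice_zero: "0 \<in> crystal_lattice D M v"
  unfolding crystal_lattice_def by (rule CollectI, rule exI[of _ "{}"]) simp

lemma crystal_lattice_uminus:
  assumes "x \<in> crystal_lattice D M v"
  shows "- x \<in> crystal_lattice D M v"
proof -
  obtain S a where x: "x = (\<Sum>w\<in>S. qscale (a w) w)" "finite S" "S \<subseteq> kashiwara_monomials D M v"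
    "\<forall>w\<in>S. a w \<in> regular_at_0"
    using assms unfolding crystal_lattice_def by auto
  have "- x = (\<Sum>w\<in>S. qscale (- a w) w)" using x by (simp add: sum_negf)
  then show ?thesis
    unfolding crystal_lattice_def using x regular_at_0_uminus
    by (intro CollectI exI[of _ S] exI[of _ "\<lambda>w. - a w"]) auto
qed

lemma crystal_lattice_add:
  assumes "x \<in> crystal_lattice D M v" "y \<in> crystal_lattice D M v"
  shows "x + y \<in> crystal_lattice D M v"
proof -
  obtain S a where x: "x = (\<Sum>w\<in>S. qscale (a w) w)" "finite S" "S \<subseteq> kashiwara_monomials D M v"
    "\<forall>w\<in>S. a w \<in> regular_at_0"
    using assms(1) unfolding crystal_lattice_def by auto
  obtain S' a' where y: "y = (\<Sum>w\<in>S'. qscale (a' w) w)" "finite S'" "S' \<subseteq> kashiwara_monomials D M v"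
    "\<forall>w\<in>S'. a' w \<in> regular_at_0"
    using assms(2) unfolding crystal_lattice_def by auto
  let ?b = "\<lambda>w. if w \<in> S then a w else 0" and ?b' = "\<lambda>w. if w \<in> S' then a' w else 0"
  have "x = (\<Sum>w\<in>S \<union> S'. qscale (?b w) w)"
    unfolding x(1) by (rule sum.mono_neutral_cong_left) (use x y in auto)
  moreover have "y = (\<Sum>w\<in>S \<union> S'. qscale (?b' w) w)"
    unfolding y(1) by (rule sum.mono_neutral_cong_left) (use x y in auto)
  ultimately have "x + y = (\<Sum>w\<in>S \<union> S'. qscale (?b w + ?b' w) w)"
    by (simp only: sum.distrib qvec.scale_left_distrib)
  then show ?thesis
    unfolding crystal_lattice_def using x y regular_at_0_add zero_regular_at_0
    by (intro CollectI exI[of _ "S \<union> S'"] exI[of _ "\<lambda>w. ?b w + ?b' w"]) auto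
qed

text \<open>A case distinction suffices: the graph \<open>kashiwara_f\<close> already supplies a
  string decomposition of some weight \<mu>. Its n-th component is n roots above \<mu> and is
  lowered n + 1 times, so every summand of the result has weight
  \<open>\<mu> - root D i\<close>.\<close>

lemma kashiwara_monomials_weight:
  assumes uq: "uq_module D M" and v: "v \<in> weight_space M \<nu>"
    and "w \<in> kashiwara_monomials D M v"
  shows "\<exists>\<mu>. w \<in> weight_space M \<mu>"
  using assms(3)
proof cases
  case base
  then show ?thesis using v by auto
next
  case (step u i)
  then obtain \<mu> c where c: "string_decomposition D M i \<mu> u c"
    and w: "w = (\<Sum>n | c n \<noteq> 0. divpow D i (actF M i) (n + 1) (c n))"
    unfolding kashiwara_f_def by auto
  have pow: "(actF M i ^^ m) x \<in> weight_space M (\<rho> - int m *s root D i)"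
    if "x \<in> weight_space M \<rho>" for m x \<rho>
  proof (induction m)
    case 0
    then show ?case using that by simp
  next
    case (Suc m)
    have "\<rho> - int m *s root D i - root D i = \<rho> - int (Suc m) *s root D i"
      by (simp add: vec_eq_iff algebra_simps)
    then show ?case using weight_space_F[OF uq Suc, of i] by (simp only: funpow.simps comp_def)
  qed
  have "divpow D i (actF M i) (n + 1) (c n) \<in> weight_space M (\<mu> - root D i)" for n
  proof -
    have "c n \<in> weight_space M (\<mu> + int n *s root D i)"
      using c by (auto simp: string_decomposition_def)
    then have "(actF M i ^^ (n + 1)) (c n) \<in>
        weight_space M (\<mu> + int n *s root D i - int (n + 1) *s root D i)"
      by (rule pow)
    also have "\<mu> + int n *s root D i - int (n + 1) *s root D i = \<mu> - root D i"
      by (simp add: vec_eq_iff algebra_simps)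
    finally show ?thesis
      unfolding divpow_def by (rule qvec.subspace_scale[OF weight_space_subspace[OF uq]])
  qed
  then have "w \<in> weight_space M (\<mu> - root D i)"
    unfolding w by (intro qvec.subspace_sum[OF weight_space_subspace[OF uq]])
  then show ?thesis by auto
qed

text \<open>Used in contrapositive form: a class other than the zero class consists of nonzero
  vectors.\<close>

lemma residue_class_eq:
  assumes "0 \<in> residue_class D M v w"
  shows "residue_class D M v w = residue_class D M v 0"
proof -
  obtain z where z: "w + qscale qvar z = 0" "z \<in> crystal_lattice D M v"
    using assms by (force simp: residue_class_def)
  then have w: "w = qscale qvar (- z)"
    by (simp add: add_eq_0_iff2)
  have "\<exists>y. w + qscale qvar x = qscale qvar y \<and> y \<in> crystal_lattice D M v"
    if "x \<in> crystal_lattice D M v" for x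
    using crystal_lattice_add[OF crystal_lattice_uminus[OF z(2)] that]
    by (intro exI[of _ "- z + x"]) (simp only: w qvec.scale_right_distrib simp_thms)
  moreover have "\<exists>y. qscale qvar x = w + qscale qvar y \<and> y \<in> crystal_lattice D M v"
    if "x \<in> crystal_lattice D M v" for x
    using that z crystal_lattice_add
    by (intro exI[of _ "z + x"]) (simp add: w qvec.scale_right_distrib)
  ultimately show ?thesis by (auto simp: residue_class_def)
qed

text \<open>The weight of a class is a \<open>SOME\<close>, which is never shown to be unique here:
  whichever weight is chosen, the class contains a vector of that weight. This vector is nonzero, so
  \<open>weight_below\<close> applies to it.\<close>

lemma module_crystal_weight_below:
  assumes hw: "irreducible_highest_weight_module D \<nu> M v"
    and b: "b \<in> elts (module_crystal D M v)"
  shows "below D \<nu> (wt (module_crystal D M v) b)"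
proof -
  have uq: "uq_module D M" and v: "v \<in> weight_space M \<nu>"
    using hw by (auto simp: irreducible_highest_weight_module_def)
  obtain w where w: "w \<in> kashiwara_monomials D M v" "b = residue_class D M v w"
    "b \<noteq> residue_class D M v 0"
    using b by (auto simp: module_crystal_def Let_def crystal_base_def)
  \<comment> \<open>The representative \<open>w\<close> lies in its own class and is a weight
    vector, so the choice in \<open>wt\<close> has a witness.\<close>
  have "w + qscale qvar 0 \<in> b" using w crystal_lattice_zero unfolding residue_class_def by blast
  then have "\<exists>\<mu>. b \<inter> weight_space M \<mu> \<noteq> {}"
    using kashiwara_monomials_weight[OF uq v w(1)] by auto
  then have "b \<inter> weight_space M (wt (module_crystal D M v) b) \<noteq> {}"
    by (simp add: module_crystal_def Let_def some_eq_ex[of "\<lambda>\<mu>. b \<inter> weight_space M \<mu> \<noteq> {}"])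
  then obtain x where x: "x \<in> b" "x \<in> weight_space M (wt (module_crystal D M v) b)" by auto
  have "x \<noteq> 0" using x(1) w residue_class_eq by metis
  then show ?thesis using weight_below[OF hw x(2)] by simp
qed

section \<open>Chains of raising operators are bounded\<close>

definition raising :: "('i, 'r::finite, 'x) crystal_data \<Rightarrow> ('x \<times> 'x) set" where
  "raising \<Gamma> = {(x, y). \<exists>i. ke \<Gamma> i x = Some y}"

lemma ke_elts_wt:
  assumes "crystal D \<Gamma>" "x \<in> elts \<Gamma>" "ke \<Gamma> i x = Some y"
  shows "y \<in> elts \<Gamma> \<and> wt \<Gamma> y = wt \<Gamma> x + root D i"
  using assms unfolding crystal_def normal_crystal_def by blast

text \<open>A chain from \<open>x\<close> to \<open>y\<close> adds simple roots to the weight, one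
  per raising. Both ends lie in one component, hence have weights below the same \<nu>; the bound is
  the number of simple roots separating the weight of \<open>x\<close> from \<nu>.\<close>

lemma raising_bounded:
  assumes km: "kac_moody_datum D" and cr: "crystal D \<Gamma>" and x: "x \<in> elts \<Gamma>"
  obtains N where "\<And>n y. (x, y) \<in> raising \<Gamma> ^^ n \<Longrightarrow> n \<le> N"
proof -
  obtain \<nu> M v \<psi> where hw: "irreducible_highest_weight_module D \<nu> M v"
    and \<psi>: "crystal_morphism (component \<Gamma> x) (module_crystal D M v) \<psi>"
    using cr x unfolding crystal_def isomorphic_to_B_def crystal_iso_def by metis
  have low: "below D \<nu> (wt \<Gamma> y)" if "y \<in> elts (component \<Gamma> x)" for y
  proof -
    have "\<psi> y \<in> elts (module_crystal D M v)" "wt (module_crystal D M v) (\<psi> y) = wt \<Gamma> y"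
      using \<psi> that by (auto simp: crystal_morphism_def component_def)
    then show ?thesis using module_crystal_weight_below[OF hw] by metis
  qed
  \<comment> \<open>\<open>c i\<close> counts how often the i-th operator occurs in the chain, so
    its total is the length.\<close>
  have chain: "y \<in> elts \<Gamma> \<and> y \<in> elts (component \<Gamma> x) \<and>
      (\<exists>c :: 'a \<Rightarrow> nat. sum c UNIV = n \<and> wt \<Gamma> y = wt \<Gamma> x + (\<Sum>i\<in>UNIV. int (c i) *s root D i))"
    if "(x, y) \<in> raising \<Gamma> ^^ n" for n y
    using that
  proof (induction n arbitrary: y)
    case 0
    then show ?case using x by (auto simp: component_def intro: exI[of _ "\<lambda>_. 0"])
  next
    case (Suc n)
    then obtain z i where z: "(x, z) \<in> raising \<Gamma> ^^ n" "ke \<Gamma> i z = Some y"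
      by (auto simp: raising_def)
    obtain c :: "'a \<Rightarrow> nat" where c: "z \<in> elts \<Gamma>" "z \<in> elts (component \<Gamma> x)" "sum c UNIV = n"
      "wt \<Gamma> z = wt \<Gamma> x + (\<Sum>i\<in>UNIV. int (c i) *s root D i)"
      using Suc.IH[OF z(1)] by auto
    have y: "y \<in> elts \<Gamma>" "wt \<Gamma> y = wt \<Gamma> z + root D i"
      using ke_elts_wt[OF cr c(1) z(2)] by simp_all
    have "y \<in> elts (component \<Gamma> x)"
      using c(2) z(2) by (auto simp: component_def intro: rtrancl_into_rtrancl)
    moreover have "sum (c(i := Suc (c i))) UNIV = Suc n"
      using c(3) by (simp add: sum.remove[of UNIV i])
    moreover have "wt \<Gamma> y = wt \<Gamma> x + (\<Sum>j\<in>UNIV. int ((c(i := Suc (c i))) j) *s root D j)"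
      unfolding sum_fun_upd_Suc using c y by simp
    ultimately show ?case using y by blast
  qed
  have "x \<in> elts (component \<Gamma> x)" by (simp add: component_def)
  then obtain m :: "'a \<Rightarrow> nat" where m: "wt \<Gamma> x = \<nu> - (\<Sum>i\<in>UNIV. int (m i) *s root D i)"
    using low unfolding below_def by metis
  have "n \<le> sum m UNIV" if n: "(x, y) \<in> raising \<Gamma> ^^ n" for n y
  proof -
    obtain c :: "'a \<Rightarrow> nat" where c: "sum c UNIV = n"
      "wt \<Gamma> y = wt \<Gamma> x + (\<Sum>i\<in>UNIV. int (c i) *s root D i)"
      using chain[OF n] by auto
    obtain l :: "'a \<Rightarrow> nat" where l: "wt \<Gamma> y = \<nu> - (\<Sum>i\<in>UNIV. int (l i) *s root D i)"
      using low chain[OF n] unfolding below_def by metis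
    \<comment> \<open>The weight of \<open>y\<close> is computed from \<open>x\<close> through
      \<open>c\<close> and from \<nu> through \<open>l\<close>. Independence of the roots turns the
      equality into \<open>c i + l i = m i\<close>, whence \<open>c i \<le> m i\<close>.\<close>
    have "(\<Sum>i\<in>UNIV. (int (c i) + int (l i) - int (m i)) *s root D i) =
      (\<Sum>i\<in>UNIV. int (c i) *s root D i) + (\<Sum>i\<in>UNIV. int (l i) *s root D i)
        - (\<Sum>i\<in>UNIV. int (m i) *s root D i)"
      unfolding sum.distrib[symmetric] sum_subtractf[symmetric]
      by (rule sum.cong) (auto simp: vec_eq_iff algebra_simps)
    also have "\<dots> = 0" using c(2) l m by (simp add: algebra_simps)
    finally have "int (c i) + int (l i) - int (m i) = 0" for i
      using km spec[of _ "\<lambda>i. int (c i) + int (l i) - int (m i)"]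
      unfolding kac_moody_datum_def lin_indep_family_def by blast
    then have "c i \<le> m i" for i by (smt (verit) of_nat_0_le_iff of_nat_le_iff)
    then show ?thesis unfolding c(1)[symmetric] by (intro sum_mono)
  qed
  then show ?thesis using that by blast
qed

text \<open>The depth is the length of a longest raising chain. A longest chain from
  \<open>y\<close>, preceded by the raising from \<open>x\<close> to \<open>y\<close>, is a longer
  chain from \<open>x\<close>.\<close>

lemma depth_function:
  assumes "kac_moody_datum D" "crystal D \<Gamma>"
  obtains d :: "'x \<Rightarrow> nat"
  where "\<And>x y i. x \<in> elts \<Gamma> \<Longrightarrow> ke \<Gamma> i x = Some y \<Longrightarrow> d y < d (x :: 'x)"
proof
  \<comment> \<open>The function provided is \<open>Greatest (P x)\<close>; the greatest element
    exists by \<open>raising_bounded\<close>.\<close>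
  define P where "P x n \<longleftrightarrow> (\<exists>y. (x, y) \<in> raising \<Gamma> ^^ n)" for x n
  fix x y i assume x: "x \<in> elts \<Gamma>" and e: "ke \<Gamma> i x = Some y"
  then have y: "y \<in> elts \<Gamma>" using ke_elts_wt[OF assms(2)] by simp
  obtain N where N: "\<And>n. P x n \<Longrightarrow> n \<le> N" using raising_bounded[OF assms x] unfolding P_def by metis
  obtain N' where N': "\<And>n. P y n \<Longrightarrow> n \<le> N'" using raising_bounded[OF assms y] unfolding P_def by metis
  have "P y 0" by (auto simp: P_def)
  then have "P y (Greatest (P y))" using N' by (rule GreatestI_nat)
  moreover have "(x, y) \<in> raising \<Gamma>" using e by (auto simp: raising_def)
  ultimately have "P x (Suc (Greatest (P y)))" unfolding P_def by (meson relpow_Suc_I2)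
  then have "Suc (Greatest (P y)) \<le> Greatest (P x)" using N by (rule Greatest_le_nat)
  then show "Greatest (P y) < Greatest (P x)" by simp
qed


section \<open>Strings in tensor products and words\<close>

text \<open>The normality conditions for a single index in local form: instead of maximal numbers of
  iterations, only the change along one arrow and the place where the arrows stop. In this form they
  pass to tensor products by case distinction, and they are symmetric in raising and
  lowering.\<close>

definition string_ops :: "'x set \<Rightarrow> ('x \<Rightarrow> 'x option) \<Rightarrow> ('x \<Rightarrow> 'x option) \<Rightarrow>
    ('x \<Rightarrow> int) \<Rightarrow> ('x \<Rightarrow> int) \<Rightarrow> bool" where
  "string_ops S e f \<epsilon> \<phi> \<longleftrightarrow> (\<forall>x\<in>S. 0 \<le> \<epsilon> x \<and> 0 \<le> \<phi> x \<and>
     (e x = None \<longleftrightarrow> \<epsilon> x = 0) \<and> (f x = None \<longleftrightarrow> \<phi> x = 0) \<and>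
     (\<forall>y. e x = Some y \<longrightarrow> y \<in> S \<and> f y = Some x \<and> \<epsilon> y = \<epsilon> x - 1 \<and> \<phi> y = \<phi> x + 1) \<and>
     (\<forall>y. f x = Some y \<longrightarrow> y \<in> S \<and> e y = Some x \<and> \<epsilon> y = \<epsilon> x + 1 \<and> \<phi> y = \<phi> x - 1))"

lemma string_opsD:
  assumes "string_ops S e f \<epsilon> \<phi>" "x \<in> S"
  shows "0 \<le> \<epsilon> x" "0 \<le> \<phi> x" "e x = None \<longleftrightarrow> \<epsilon> x = 0" "f x = None \<longleftrightarrow> \<phi> x = 0"
    and "e x = Some y \<Longrightarrow> y \<in> S \<and> f y = Some x \<and> \<epsilon> y = \<epsilon> x - 1 \<and> \<phi> y = \<phi> x + 1"
    and "f x = Some y \<Longrightarrow> y \<in> S \<and> e y = Some x \<and> \<epsilon> y = \<epsilon> x + 1 \<and> \<phi> y = \<phi> x - 1"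
  using assms unfolding string_ops_def by blast+

lemma string_opsI:
  assumes "\<And>x. x \<in> S \<Longrightarrow> 0 \<le> \<epsilon> x" "\<And>x. x \<in> S \<Longrightarrow> 0 \<le> \<phi> x"
    "\<And>x. x \<in> S \<Longrightarrow> e x = None \<longleftrightarrow> \<epsilon> x = 0" "\<And>x. x \<in> S \<Longrightarrow> f x = None \<longleftrightarrow> \<phi> x = 0"
    "\<And>x y. x \<in> S \<Longrightarrow> e x = Some y \<Longrightarrow> y \<in> S \<and> f y = Some x \<and> \<epsilon> y = \<epsilon> x - 1 \<and> \<phi> y = \<phi> x + 1"
    "\<And>x y. x \<in> S \<Longrightarrow> f x = Some y \<Longrightarrow> y \<in> S \<and> e y = Some x \<and> \<epsilon> y = \<epsilon> x + 1 \<and> \<phi> y = \<phi> x - 1"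
  shows "string_ops S e f \<epsilon> \<phi>"
  using assms unfolding string_ops_def by blast

lemma string_ops_swap: "string_ops S e f \<epsilon> \<phi> \<Longrightarrow> string_ops S f e \<phi> \<epsilon>"
  unfolding string_ops_def by blast

lemma string_ops_cong:
  assumes "string_ops S e f \<epsilon> \<phi>" "\<And>x. x \<in> S \<Longrightarrow> \<epsilon>' x = \<epsilon> x" "\<And>x. x \<in> S \<Longrightarrow> \<phi>' x = \<phi> x"
    and "\<And>x. x \<in> S \<Longrightarrow> e' x = e x" "\<And>x. x \<in> S \<Longrightarrow> f' x = f x"
  shows "string_ops S e' f' \<epsilon>' \<phi>'"
proof (rule string_opsI)
  fix x assume x: "x \<in> S"
  note D = string_opsD[OF assms(1) x]
  show "0 \<le> \<epsilon>' x" "0 \<le> \<phi>' x" "e' x = None \<longleftrightarrow> \<epsilon>' x = 0" "f' x = None \<longleftrightarrow> \<phi>' x = 0"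
    using D(1-4) assms(2-5) x by auto
  show "y \<in> S \<and> f' y = Some x \<and> \<epsilon>' y = \<epsilon>' x - 1 \<and> \<phi>' y = \<phi>' x + 1" if "e' x = Some y" for y
    using D(5)[of y] that assms(2-5) x by simp
  show "y \<in> S \<and> e' y = Some x \<and> \<epsilon>' y = \<epsilon>' x + 1 \<and> \<phi>' y = \<phi>' x - 1" if "f' x = Some y" for y
    using D(6)[of y] that assms(2-5) x by simp
qed

lemma iter_op_Suc_left: "iter_op k (Suc n) x = Option.bind (k x) (iter_op k n)"
  by (induction n) (cases "k x"; simp)+

lemma is_string_length_unique: "is_string_length k x m \<Longrightarrow> is_string_length k x n \<Longrightarrow> m = n"
  by (auto simp: is_string_length_def intro: antisym)

lemma is_string_length_None: "k x = None \<Longrightarrow> is_string_length k x 0"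
  unfolding is_string_length_def
  by (metis bind_eq_None_conv iter_op.simps(1) iter_op_Suc_left not0_implies_Suc option.distinct(1) order_refl)

lemma is_string_length_Some:
  assumes "k x = Some y"
  shows "is_string_length k x (Suc n) \<longleftrightarrow> is_string_length k y n"
proof -
  have "iter_op k (Suc m) x = iter_op k m y" for m
    using assms by (simp only: iter_op_Suc_left) simp
  moreover have "(\<forall>m. iter_op k m x \<noteq> None \<longrightarrow> m \<le> Suc n) \<longleftrightarrow>
      (\<forall>m. iter_op k (Suc m) x \<noteq> None \<longrightarrow> m \<le> n)"
    by (metis Suc_le_mono not0_implies_Suc zero_le)
  ultimately show ?thesis by (simp only: is_string_length_def)
qed

lemma is_string_length_pos:
  assumes "k x = Some y" "is_string_length k x n"
  shows "n > 0"
proof -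
  have "iter_op k (Suc 0) x \<noteq> None" using assms(1) by simp
  then show ?thesis using assms(2) unfolding is_string_length_def by fastforce
qed

lemma string_length_eq: "is_string_length k x n \<Longrightarrow> string_length k x = n"
  unfolding string_length_def is_string_length_def by (rule Greatest_equality) auto

text \<open>The way back from the local form: \<epsilon> drops by one along each arrow and reaches 0
  exactly where \<open>e\<close> is undefined, so it counts the iterations.\<close>

lemma string_ops_is_string_length:
  assumes "string_ops S e f \<epsilon> \<phi>" "x \<in> S"
  shows "is_string_length e x (nat (\<epsilon> x))"
  using assms(2)
proof (induction "nat (\<epsilon> x)" arbitrary: x)
  case 0
  then have "e x = None" using string_opsD(1,3)[OF assms(1) 0(2)] by simp
  then show ?case using 0 by (simp add: is_string_length_None)
next
  case (Suc n)
  then have "e x \<noteq> None" using string_opsD(1,3)[OF assms(1) Suc(3)] by auto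
  then obtain y where y: "e x = Some y" by auto
  then have "y \<in> S" "\<epsilon> y = \<epsilon> x - 1" using string_opsD(5)[OF assms(1) Suc(3) y] by simp_all
  moreover from this have n: "n = nat (\<epsilon> y)" using Suc(2) by simp
  ultimately have "is_string_length e y n" using Suc(1) by metis
  then show ?case using is_string_length_Some[of e x y n] y Suc(2) by simp
qed

definition normal_strings :: "('i, 'r::finite, 'x) crystal_data \<Rightarrow> bool" where
  "normal_strings \<Gamma> \<longleftrightarrow>
     (\<forall>i. string_ops (elts \<Gamma>) (ke \<Gamma> i) (kf \<Gamma> i) (eps \<Gamma> i) (phi \<Gamma> i))"

lemma normal_crystal_strings:
  assumes "normal_crystal D \<Gamma>"
  shows "normal_strings \<Gamma>"
proof -
  \<comment> \<open>Used along the raising arrow from \<open>x\<close> to \<open>y\<close> for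
    \<open>eps\<close>, and along the lowering arrow from \<open>y\<close> back to \<open>x\<close>
    for \<open>phi\<close>.\<close>
  have step: "\<epsilon> y = \<epsilon> x - 1" if s: "k x = Some y" "\<epsilon> x = int m" "is_string_length k x m"
    "\<epsilon> y = int n" "is_string_length k y n" for k :: "'c \<Rightarrow> 'c option" and \<epsilon> :: "'c \<Rightarrow> int" and x y m n
  proof -
    obtain m' where "m = Suc m'" using is_string_length_pos[OF s(1) s(3)] by (cases m) auto
    then show ?thesis
      using s is_string_length_Some[of k x y m'] is_string_length_unique[of k y m' n] by simp
  qed
  have N: "phi \<Gamma> i x - eps \<Gamma> i x = pairing (coroot D i) (wt \<Gamma> x) \<and>
        (\<exists>n. eps \<Gamma> i x = int n \<and> is_string_length (ke \<Gamma> i) x n) \<and>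
        (\<exists>n. phi \<Gamma> i x = int n \<and> is_string_length (kf \<Gamma> i) x n) \<and>
        (\<forall>y. ke \<Gamma> i x = Some y \<longrightarrow> y \<in> elts \<Gamma> \<and> wt \<Gamma> y = wt \<Gamma> x + root D i) \<and>
        (\<forall>y. kf \<Gamma> i x = Some y \<longrightarrow> y \<in> elts \<Gamma> \<and> wt \<Gamma> y = wt \<Gamma> x - root D i) \<and>
        (\<forall>y\<in>elts \<Gamma>. ke \<Gamma> i x = Some y \<longleftrightarrow> kf \<Gamma> i y = Some x)" if "x \<in> elts \<Gamma>" for x i
    using that assms unfolding normal_crystal_def by blast
  have zero: "k x = None \<longleftrightarrow> n = 0" if "is_string_length k x n" for k :: "'c \<Rightarrow> 'c option" and x n
    using is_string_length_pos that is_string_length_None is_string_length_unique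
    by (metis less_irrefl option.exhaust)
  show ?thesis
    unfolding normal_strings_def
  proof (rule allI, rule string_opsI)
    fix i x assume x: "x \<in> elts \<Gamma>"
    obtain m n where mn: "eps \<Gamma> i x = int m" "is_string_length (ke \<Gamma> i) x m"
      "phi \<Gamma> i x = int n" "is_string_length (kf \<Gamma> i) x n"
      using N[OF x] by metis
    show "0 \<le> eps \<Gamma> i x" "0 \<le> phi \<Gamma> i x" "ke \<Gamma> i x = None \<longleftrightarrow> eps \<Gamma> i x = 0"
      "kf \<Gamma> i x = None \<longleftrightarrow> phi \<Gamma> i x = 0"
      using mn zero[OF mn(2)] zero[OF mn(4)] by auto
    show "y \<in> elts \<Gamma> \<and> kf \<Gamma> i y = Some x \<and> eps \<Gamma> i y = eps \<Gamma> i x - 1 \<and> phi \<Gamma> i y = phi \<Gamma> i x + 1"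
      if y: "ke \<Gamma> i x = Some y" for y
    proof -
      have yG: "y \<in> elts \<Gamma>" using N[OF x] y by blast
      have f: "kf \<Gamma> i y = Some x" using N[OF x] y yG by blast
      obtain m' n' where mn': "eps \<Gamma> i y = int m'" "is_string_length (ke \<Gamma> i) y m'"
        "phi \<Gamma> i y = int n'" "is_string_length (kf \<Gamma> i) y n'"
        using N[OF yG] by metis
      show ?thesis
        using yG f step[OF y mn(1,2) mn'(1,2)] step[OF f mn'(3,4) mn(3,4)] by simp
    qed
    show "y \<in> elts \<Gamma> \<and> ke \<Gamma> i y = Some x \<and> eps \<Gamma> i y = eps \<Gamma> i x + 1 \<and> phi \<Gamma> i y = phi \<Gamma> i x - 1"
      if y: "kf \<Gamma> i x = Some y" for y
    proof -
      have yG: "y \<in> elts \<Gamma>" using N[OF x] y by blast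
      have f: "ke \<Gamma> i y = Some x" using N[OF yG] x y by blast
      obtain m' n' where mn': "eps \<Gamma> i y = int m'" "is_string_length (ke \<Gamma> i) y m'"
        "phi \<Gamma> i y = int n'" "is_string_length (kf \<Gamma> i) y n'"
        using N[OF yG] by metis
      show ?thesis
        using yG f step[OF y mn(3,4) mn'(3,4)] step[OF f mn'(1,2) mn(1,2)] by simp
    qed
  qed
qed

text \<open>The formulas for \<epsilon> and \<phi> express the cancellation of \<phi> of the left
  factor against \<epsilon>' of the right one. The weak inequality for raising and the strict one
  for lowering fit together: an arrow shifts the compared number by one, so the opposite operator
  selects the same factor again.\<close>

lemma string_ops_tensor:
  assumes "string_ops S e f \<epsilon> \<phi>" "string_ops S' e' f' \<epsilon>' \<phi>'"
  shows "string_ops (S \<times> S')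
    (\<lambda>(u, v). if \<phi> u \<ge> \<epsilon>' v then map_option (\<lambda>u'. (u', v)) (e u) else map_option (\<lambda>v'. (u, v')) (e' v))
    (\<lambda>(u, v). if \<phi> u > \<epsilon>' v then map_option (\<lambda>u'. (u', v)) (f u) else map_option (\<lambda>v'. (u, v')) (f' v))
    (\<lambda>(u, v). \<epsilon> u + max 0 (\<epsilon>' v - \<phi> u)) (\<lambda>(u, v). \<phi>' v + max 0 (\<phi> u - \<epsilon>' v))"
    (is "string_ops _ ?e ?f ?\<epsilon> ?\<phi>")
proof (rule string_opsI)
  fix z assume "z \<in> S \<times> S'"
  then obtain u v where z: "z = (u, v)" and uv: "u \<in> S" "v \<in> S'" by auto
  note u = string_opsD[OF assms(1) uv(1)]
  note v = string_opsD[OF assms(2) uv(2)]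
  show "0 \<le> ?\<epsilon> z" "0 \<le> ?\<phi> z" using u(1,2) v(1,2) by (simp_all add: z)
  show "?e z = None \<longleftrightarrow> ?\<epsilon> z = 0"
    using u(1-3) v(1-3) by (simp add: z max_def)
  show "?f z = None \<longleftrightarrow> ?\<phi> z = 0"
    using u(1,2,4) v(1,2,4) by (simp add: z max_def)
  show "y \<in> S \<times> S' \<and> ?f y = Some z \<and> ?\<epsilon> y = ?\<epsilon> z - 1 \<and> ?\<phi> y = ?\<phi> z + 1" if y: "?e z = Some y" for y
  proof (cases "\<epsilon>' v \<le> \<phi> u")
    case True
    then obtain u' where "e u = Some u'" "y = (u', v)" using y by (auto simp: z)
    then show ?thesis using True u(5)[of u'] uv by (simp add: z max_def)
  next
    case False
    then obtain v' where "e' v = Some v'" "y = (u, v')" using y by (auto simp: z)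
    then show ?thesis using False v(5)[of v'] uv by (simp add: z max_def)
  qed
  show "y \<in> S \<times> S' \<and> ?e y = Some z \<and> ?\<epsilon> y = ?\<epsilon> z + 1 \<and> ?\<phi> y = ?\<phi> z - 1" if y: "?f z = Some y" for y
  proof (cases "\<epsilon>' v < \<phi> u")
    case True
    then obtain u' where "f u = Some u'" "y = (u', v)" using y by (auto simp: z)
    then show ?thesis using True u(6)[of u'] uv by (simp add: z max_def)
  next
    case False
    then obtain v' where "f' v = Some v'" "y = (u, v')" using y by (auto simp: z)
    then show ?thesis using False v(6)[of v'] uv by (simp add: z max_def)
  qed
qed

text \<open>In \<open>tensor\<close> the values of \<open>eps\<close> and \<open>phi\<close> are
  defined as string lengths; uniqueness of string lengths identifies them with the explicit
  formulas.\<close>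

lemma tensor_normal_strings:
  assumes "normal_strings \<Gamma>" "normal_strings \<Delta>"
  shows "normal_strings (tensor \<Gamma> \<Delta>)"
    and "\<And>u v i. u \<in> elts \<Gamma> \<Longrightarrow> v \<in> elts \<Delta> \<Longrightarrow>
      eps (tensor \<Gamma> \<Delta>) i (u, v) = eps \<Gamma> i u + max 0 (eps \<Delta> i v - phi \<Gamma> i u)"
    and "\<And>u v i. u \<in> elts \<Gamma> \<Longrightarrow> v \<in> elts \<Delta> \<Longrightarrow>
      phi (tensor \<Gamma> \<Delta>) i (u, v) = phi \<Delta> i v + max 0 (phi \<Gamma> i u - eps \<Delta> i v)"
proof -
  let ?e = "\<lambda>i. \<lambda>(u, v). eps \<Gamma> i u + max 0 (eps \<Delta> i v - phi \<Gamma> i u)"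
  let ?p = "\<lambda>i. \<lambda>(u, v). phi \<Delta> i v + max 0 (phi \<Gamma> i u - eps \<Delta> i v)"
  have ops: "string_ops (elts \<Gamma> \<times> elts \<Delta>) (ke (tensor \<Gamma> \<Delta>) i) (kf (tensor \<Gamma> \<Delta>) i) (?e i) (?p i)" for i
    using string_ops_tensor[OF assms[unfolded normal_strings_def, THEN spec[of _ i]]]
    by (simp add: tensor_def Let_def)
  have e: "eps (tensor \<Gamma> \<Delta>) i z = ?e i z" if "z \<in> elts \<Gamma> \<times> elts \<Delta>" for i z
  proof -
    have "eps (tensor \<Gamma> \<Delta>) i z = int (string_length (ke (tensor \<Gamma> \<Delta>) i) z)"
      by (simp add: tensor_def Let_def)
    also have "\<dots> = int (nat (?e i z))"
      using string_length_eq[OF string_ops_is_string_length[OF ops that]] by simp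
    also have "\<dots> = ?e i z" using string_opsD(1)[OF ops that] by simp
    finally show ?thesis .
  qed
  have p: "phi (tensor \<Gamma> \<Delta>) i z = ?p i z" if "z \<in> elts \<Gamma> \<times> elts \<Delta>" for i z
  proof -
    have "phi (tensor \<Gamma> \<Delta>) i z = int (string_length (kf (tensor \<Gamma> \<Delta>) i) z)"
      by (simp add: tensor_def Let_def)
    also have "\<dots> = int (nat (?p i z))"
      using string_length_eq[OF string_ops_is_string_length[OF string_ops_swap[OF ops] that]] by simp
    also have "\<dots> = ?p i z" using string_opsD(2)[OF ops that] by simp
    finally show ?thesis .
  qed
  have "elts (tensor \<Gamma> \<Delta>) = elts \<Gamma> \<times> elts \<Delta>" by (simp add: tensor_def Let_def)
  then show "normal_strings (tensor \<Gamma> \<Delta>)"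
    unfolding normal_strings_def using string_ops_cong[OF ops e p refl refl] by simp
  show "\<And>u v i. u \<in> elts \<Gamma> \<Longrightarrow> v \<in> elts \<Delta> \<Longrightarrow>
      eps (tensor \<Gamma> \<Delta>) i (u, v) = eps \<Gamma> i u + max 0 (eps \<Delta> i v - phi \<Gamma> i u)"
    using e by simp
  show "\<And>u v i. u \<in> elts \<Gamma> \<Longrightarrow> v \<in> elts \<Delta> \<Longrightarrow>
      phi (tensor \<Gamma> \<Delta>) i (u, v) = phi \<Delta> i v + max 0 (phi \<Gamma> i u - eps \<Delta> i v)"
    using p by simp
qed

lemma normal_strings_ops:
  "normal_strings \<Gamma> \<Longrightarrow> string_ops (elts \<Gamma>) (ke \<Gamma> i) (kf \<Gamma> i) (eps \<Gamma> i) (phi \<Gamma> i)"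
  by (simp add: normal_strings_def)

lemma relabel_normal_strings:
  assumes "normal_strings \<Gamma>" "\<And>x. d (c x) = x"
  shows "normal_strings (relabel c d \<Gamma>)"
  unfolding normal_strings_def
proof (rule allI, rule string_opsI)
  fix i z assume "z \<in> elts (relabel c d \<Gamma>)"
  then obtain x where z: "z = c x" "x \<in> elts \<Gamma>" by (auto simp: relabel_def)
  note D = string_opsD[OF normal_strings_ops[OF assms(1)] z(2), of i]
  show "0 \<le> eps (relabel c d \<Gamma>) i z" "0 \<le> phi (relabel c d \<Gamma>) i z"
    "ke (relabel c d \<Gamma>) i z = None \<longleftrightarrow> eps (relabel c d \<Gamma>) i z = 0"
    "kf (relabel c d \<Gamma>) i z = None \<longleftrightarrow> phi (relabel c d \<Gamma>) i z = 0"
    using D(1-4) by (simp_all add: relabel_def z assms(2))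
  fix y
  show "y \<in> elts (relabel c d \<Gamma>) \<and> kf (relabel c d \<Gamma>) i y = Some z \<and>
      eps (relabel c d \<Gamma>) i y = eps (relabel c d \<Gamma>) i z - 1 \<and>
      phi (relabel c d \<Gamma>) i y = phi (relabel c d \<Gamma>) i z + 1"
    if "ke (relabel c d \<Gamma>) i z = Some y"
    using that D(5) by (auto simp: relabel_def z assms(2))
  show "y \<in> elts (relabel c d \<Gamma>) \<and> ke (relabel c d \<Gamma>) i y = Some z \<and>
      eps (relabel c d \<Gamma>) i y = eps (relabel c d \<Gamma>) i z + 1 \<and>
      phi (relabel c d \<Gamma>) i y = phi (relabel c d \<Gamma>) i z - 1"
    if "kf (relabel c d \<Gamma>) i z = Some y"
    using that D(6) by (auto simp: relabel_def z assms(2))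
qed

section \<open>The crystal of words and its operators on concatenations\<close>

abbreviation cons_pair :: "'a \<times> 'a list \<Rightarrow> 'a list" where
  "cons_pair \<equiv> \<lambda>(x, w). x # w"

lemma elts_tensor_power: "elts (tensor_power \<Gamma> n) = {w \<in> lists (elts \<Gamma>). length w = n}"
proof (induction n)
  case 0
  show ?case by (auto simp: unit_crystal_def)
next
  case (Suc n)
  show ?case
  proof (intro set_eqI iffI)
    fix w assume "w \<in> {w \<in> lists (elts \<Gamma>). length w = Suc n}"
    then obtain x u where "w = cons_pair (x, u)" "x \<in> elts \<Gamma>" "u \<in> lists (elts \<Gamma>)" "length u = n"
      by (cases w) auto
    then show "w \<in> elts (tensor_power \<Gamma> (Suc n))"
      using Suc by (auto simp: relabel_def tensor_def Let_def image_iff)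
  qed (use Suc in \<open>auto simp: relabel_def tensor_def Let_def\<close>)
qed

lemma elts_words: "elts (words \<Gamma>) = lists (elts \<Gamma>)"
  by (auto simp: words_def elts_tensor_power)

lemma tensor_power_normal_strings:
  assumes "normal_strings \<Gamma>"
  shows "normal_strings (tensor_power \<Gamma> n)"
proof (induction n)
  case 0
  show ?case by (simp add: unit_crystal_def normal_strings_def string_ops_def)
next
  case (Suc n)
  then show ?case
    using relabel_normal_strings[OF tensor_normal_strings(1)[OF assms], where d="\<lambda>w. (hd w, tl w)" and c=cons_pair]
    by auto
qed

text \<open>The Boolean selects raising (\<open>True\<close>) or lowering (\<open>False\<close>), so
  that both are treated at once and negation yields the inverse operator.\<close>

definition kop :: "bool \<Rightarrow> ('i, 'r::finite, 'x) crystal_data \<Rightarrow> 'i \<Rightarrow> 'x \<Rightarrow> 'x option" where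
  "kop b \<Gamma> i = (if b then ke \<Gamma> i else kf \<Gamma> i)"

text \<open>The test of the tensor product rule, with \<open>p\<close> the \<open>phi\<close> of the
  left factor and \<open>q\<close> the \<open>eps\<close> of the right one.\<close>

definition acts_left :: "bool \<Rightarrow> int \<Rightarrow> int \<Rightarrow> bool" where
  "acts_left b p q \<longleftrightarrow> (if b then q \<le> p else q < p)"

text \<open>The operators have no fixed points because \<open>eps\<close> changes by one; this
  distinguishes the branches of \<open>step_op\<close> later.\<close>

lemma kop_closed:
  assumes "normal_strings \<Gamma>" "x \<in> elts \<Gamma>" "kop b \<Gamma> i x = Some y"
  shows "y \<in> elts \<Gamma>" "kop (\<not> b) \<Gamma> i y = Some x" "y \<noteq> x"
  using string_opsD(5,6)[OF normal_strings_ops[OF assms(1)] assms(2), of i y] assms(3)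
  by (auto simp: kop_def split: if_splits)

lemma kop_tensor: "kop b (tensor \<Gamma> \<Delta>) i (u, v) =
   (if acts_left b (phi \<Gamma> i u) (eps \<Delta> i v) then map_option (\<lambda>u'. (u', v)) (kop b \<Gamma> i u)
    else map_option (\<lambda>v'. (u, v')) (kop b \<Delta> i v))"
  by (simp add: kop_def acts_left_def tensor_def Let_def)

lemma words_Nil: "eps (words \<Gamma>) i [] = 0" "phi (words \<Gamma>) i [] = 0" "kop b (words \<Gamma>) i [] = None"
  by (auto simp: words_def unit_crystal_def kop_def)

text \<open>On words of a fixed length, \<open>words\<close> coincides with a single tensor power.
  Keeping the length in the carrier also yields that operators preserve it.\<close>

lemma words_string_ops:
  assumes "normal_strings \<Gamma>"
  shows "string_ops {w \<in> lists (elts \<Gamma>). length w = n}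
    (ke (words \<Gamma>) i) (kf (words \<Gamma>) i) (eps (words \<Gamma>) i) (phi (words \<Gamma>) i)"
  by (rule string_ops_cong[OF normal_strings_ops[OF tensor_power_normal_strings[OF assms, of n],
        unfolded elts_tensor_power]])
    (auto simp: words_def)

lemma words_normal_strings:
  assumes "normal_strings \<Gamma>"
  shows "normal_strings (words \<Gamma>)"
  unfolding normal_strings_def elts_words
proof (rule allI, rule string_opsI)
  fix i w assume "w \<in> lists (elts \<Gamma>)"
  then have "w \<in> {u \<in> lists (elts \<Gamma>). length u = length w}" by simp
  note D = string_opsD[OF words_string_ops[OF assms] this, of i]
  show "0 \<le> eps (words \<Gamma>) i w" "0 \<le> phi (words \<Gamma>) i w"
    "ke (words \<Gamma>) i w = None \<longleftrightarrow> eps (words \<Gamma>) i w = 0"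
    "kf (words \<Gamma>) i w = None \<longleftrightarrow> phi (words \<Gamma>) i w = 0"
    using D(1-4) by simp_all
  fix y
  show "y \<in> lists (elts \<Gamma>) \<and> kf (words \<Gamma>) i y = Some w \<and>
      eps (words \<Gamma>) i y = eps (words \<Gamma>) i w - 1 \<and> phi (words \<Gamma>) i y = phi (words \<Gamma>) i w + 1"
    if "ke (words \<Gamma>) i w = Some y"
    using D(5)[OF that] by blast
  show "y \<in> lists (elts \<Gamma>) \<and> ke (words \<Gamma>) i y = Some w \<and>
      eps (words \<Gamma>) i y = eps (words \<Gamma>) i w + 1 \<and> phi (words \<Gamma>) i y = phi (words \<Gamma>) i w - 1"
    if "kf (words \<Gamma>) i w = Some y"
    using D(6)[OF that] by blast
qed

lemma kop_words_length:
  assumes "normal_strings \<Gamma>" "w \<in> lists (elts \<Gamma>)" "kop b (words \<Gamma>) i w = Some w'"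
  shows "length w' = length w"
proof -
  have "w \<in> {u \<in> lists (elts \<Gamma>). length u = length w}" using assms(2) by simp
  note D = string_opsD(5,6)[OF words_string_ops[OF assms(1)] this, of i w']
  show ?thesis using D assms(3) by (auto simp: kop_def split: if_splits)
qed

lemma eps_phi_nonneg:
  assumes "normal_strings \<Gamma>" "x \<in> elts \<Gamma>"
  shows "0 \<le> eps \<Gamma> i x" "0 \<le> phi \<Gamma> i x"
  using string_opsD(1,2)[OF normal_strings_ops[OF assms(1)] assms(2)] by auto

lemmas words_nonneg = eps_phi_nonneg[OF words_normal_strings, unfolded elts_words]

lemma kop_None_iff:
  assumes "normal_strings \<Gamma>" "w \<in> elts \<Gamma>"
  shows "kop b \<Gamma> i w = None \<longleftrightarrow> (if b then eps \<Gamma> i w = 0 else phi \<Gamma> i w = 0)"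
  using string_opsD(3,4)[OF normal_strings_ops[OF assms(1)] assms(2)] by (simp add: kop_def)

lemma words_Cons:
  assumes "normal_strings \<Gamma>" "x \<in> elts \<Gamma>" "w \<in> lists (elts \<Gamma>)"
  shows "eps (words \<Gamma>) i (x # w) = eps \<Gamma> i x + max 0 (eps (words \<Gamma>) i w - phi \<Gamma> i x)"
    and "phi (words \<Gamma>) i (x # w) = phi (words \<Gamma>) i w + max 0 (phi \<Gamma> i x - eps (words \<Gamma>) i w)"
    and "kop b (words \<Gamma>) i (x # w) =
      (if acts_left b (phi \<Gamma> i x) (eps (words \<Gamma>) i w) then map_option (\<lambda>y. y # w) (kop b \<Gamma> i x)
       else map_option ((#) x) (kop b (words \<Gamma>) i w))"
proof -
  have w: "w \<in> elts (tensor_power \<Gamma> (length w))" using assms by (simp add: elts_tensor_power)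
  note t = tensor_normal_strings(2,3)[OF assms(1) tensor_power_normal_strings[OF assms(1)] assms(2) w]
  show "eps (words \<Gamma>) i (x # w) = eps \<Gamma> i x + max 0 (eps (words \<Gamma>) i w - phi \<Gamma> i x)"
    "phi (words \<Gamma>) i (x # w) = phi (words \<Gamma>) i w + max 0 (phi \<Gamma> i x - eps (words \<Gamma>) i w)"
    using t by (auto simp: words_def relabel_def)
  have "kop b (words \<Gamma>) i (x # w) =
      map_option cons_pair (kop b (tensor \<Gamma> (tensor_power \<Gamma> (length w))) i (x, w))"
    by (simp add: words_def relabel_def kop_def)
  also have "\<dots> = (if acts_left b (phi \<Gamma> i x) (eps (words \<Gamma>) i w) then map_option (\<lambda>y. y # w) (kop b \<Gamma> i x)
       else map_option ((#) x) (kop b (words \<Gamma>) i w))"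
    by (auto simp: kop_tensor option.map_comp comp_def) (auto simp: words_def kop_def)
  finally show "kop b (words \<Gamma>) i (x # w) = \<dots>" .
qed

text \<open>Tensor powers are bracketed to the right, so a formula for an arbitrary cut is an
  instance of associativity. It is proved letter by letter, and \<open>kop_append\<close> follows
  the same pattern.\<close>

lemma words_append:
  assumes "normal_strings \<Gamma>" "v \<in> lists (elts \<Gamma>)" "u \<in> lists (elts \<Gamma>)"
  shows "eps (words \<Gamma>) i (u @ v) = eps (words \<Gamma>) i u + max 0 (eps (words \<Gamma>) i v - phi (words \<Gamma>) i u) \<and>
     phi (words \<Gamma>) i (u @ v) = phi (words \<Gamma>) i v + max 0 (phi (words \<Gamma>) i u - eps (words \<Gamma>) i v)"
  using assms(3)
proof (induction u)
  case Nil
  show ?case using words_nonneg[OF assms(1,2), of i] by (simp add: words_Nil)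
next
  case (Cons x u)
  note ge = eps_phi_nonneg[OF assms(1) Cons(1), of i]
  have uv: "u @ v \<in> lists (elts \<Gamma>)" using Cons assms(2) by auto
  show ?case
    using Cons ge words_nonneg[OF assms(1,2), of i] words_nonneg[OF assms(1) Cons(2), of i]
    by (simp add: words_Cons[OF assms(1) Cons(1) uv] words_Cons[OF assms(1) Cons(1,2)] max_def)
qed

lemma kop_append:
  assumes "normal_strings \<Gamma>" "v \<in> lists (elts \<Gamma>)" "u \<in> lists (elts \<Gamma>)"
  shows "kop b (words \<Gamma>) i (u @ v) =
    (if acts_left b (phi (words \<Gamma>) i u) (eps (words \<Gamma>) i v)
     then map_option (\<lambda>u'. u' @ v) (kop b (words \<Gamma>) i u)
     else map_option ((@) u) (kop b (words \<Gamma>) i v))"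
  using assms(3)
proof (induction u)
  case Nil
  \<comment> \<open>For an empty left factor \<open>acts_left\<close> can hold only for raising with
    \<open>eps\<close> of \<open>v\<close> equal to 0, and then the operator is undefined on
    \<open>v\<close> as well.\<close>
  show ?case using words_nonneg[OF assms(1,2), of i]
      kop_None_iff[OF words_normal_strings[OF assms(1)], of v b i] assms(2)
    by (auto simp: words_Nil acts_left_def elts_words option.map_ident split: if_splits)
next
  case (Cons x u)
  note ge = eps_phi_nonneg[OF assms(1) Cons(1), of i]
  have uv: "u @ v \<in> lists (elts \<Gamma>)" using Cons assms(2) by auto
  note nn = words_nonneg[OF assms(1,2), of i] words_nonneg[OF assms(1) Cons(2), of i]
  show ?case
    using Cons(3) ge nn words_append[OF assms(1,2) Cons(2), of i]
    by (auto simp: words_Cons[OF assms(1) Cons(1) uv] words_Cons[OF assms(1) Cons(1,2)] max_def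
      acts_left_def option.map_comp comp_def split: if_splits)
qed


section \<open>Transfer along Kashiwara operators\<close>

definition one_step :: "('o, 's) rewriting_system \<Rightarrow> 'o \<Rightarrow> 'o \<Rightarrow> bool" where
  "one_step A x y \<longleftrightarrow> (\<exists>s\<in>steps A. source A s = x \<and> target A s = y)"

definition joinable :: "('o, 's) rewriting_system \<Rightarrow> 'o \<Rightarrow> 'o \<Rightarrow> bool" where
  "joinable A y z \<longleftrightarrow> (\<exists>w. (one_step A)\<^sup>*\<^sup>* y w \<and> (one_step A)\<^sup>*\<^sup>* z w)"

locale ars =
  fixes A :: "('o, 's) rewriting_system"
  assumes source_objs: "s \<in> steps A \<Longrightarrow> source A s \<in> objs A"
    and target_objs: "s \<in> steps A \<Longrightarrow> target A s \<in> objs A"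
begin

lemma is_sequence_reach:
  "is_sequence A x ss \<Longrightarrow> x \<in> objs A \<and> seq_target A (x, ss) \<in> objs A \<and>
     (one_step A)\<^sup>*\<^sup>* x (seq_target A (x, ss))"
proof (induction ss arbitrary: x)
  case (Cons s ss)
  then have "one_step A x (target A s)" by (auto simp: one_step_def)
  moreover have "seq_target A (x, s # ss) = seq_target A (target A s, ss)" by simp
  ultimately show ?case using Cons.IH[of "target A s"] Cons.prems
    by (metis converse_rtranclp_into_rtranclp is_sequence.simps(2))
qed simp

lemma reach_is_sequence:
  assumes "(one_step A)\<^sup>*\<^sup>* x y" "x \<in> objs A"
  shows "\<exists>ss. is_sequence A x ss \<and> seq_target A (x, ss) = y"
  using assms
proof (induction rule: converse_rtranclp_induct)
  case base
  then show ?case by (intro exI[of _ "[]"]) simp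
next
  case (step x z)
  then obtain s where s: "s \<in> steps A" "source A s = x" "target A s = z"
    by (auto simp: one_step_def)
  then obtain ss where "is_sequence A z ss" "seq_target A (z, ss) = y"
    using step target_objs by metis
  then show ?case using s step(4) by (intro exI[of _ "s # ss"]) auto
qed

text \<open>Reachability is reflexive at every point, whereas an empty sequence exists only at an
  object; hence the two membership hypotheses.\<close>

lemma confluent_branching_iff:
  assumes "seq_target A (fst b) \<in> objs A" "seq_target A (snd b) \<in> objs A"
  shows "confluent_branching A b \<longleftrightarrow> joinable A (seq_target A (fst b)) (seq_target A (snd b))"
proof
  assume "confluent_branching A b"
  then obtain r s where "is_sequence A (seq_target A (fst b)) r"
    "is_sequence A (seq_target A (snd b)) s"
    "seq_target A (seq_target A (fst b), r) = seq_target A (seq_target A (snd b), s)"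
    unfolding confluent_branching_def finite_sequences_def by force
  then show "joinable A (seq_target A (fst b)) (seq_target A (snd b))"
    unfolding joinable_def using is_sequence_reach by metis
next
  assume "joinable A (seq_target A (fst b)) (seq_target A (snd b))"
  then obtain w where "(one_step A)\<^sup>*\<^sup>* (seq_target A (fst b)) w"
    "(one_step A)\<^sup>*\<^sup>* (seq_target A (snd b)) w"
    by (auto simp: joinable_def)
  then obtain r s where rs: "is_sequence A (seq_target A (fst b)) r"
      "seq_target A (seq_target A (fst b), r) = w"
      "is_sequence A (seq_target A (snd b)) s" "seq_target A (seq_target A (snd b), s) = w"
    using reach_is_sequence assms by meson
  show "confluent_branching A b"
    unfolding confluent_branching_def
    by (rule bexI[of _ "(seq_target A (fst b), r)"], rule bexI[of _ "(seq_target A (snd b), s)"])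
      (use rs in \<open>simp_all add: finite_sequences_def\<close>)
qed

lemma confluent_iff:
  "confluent A \<longleftrightarrow>
     (\<forall>x\<in>objs A. \<forall>y z. (one_step A)\<^sup>*\<^sup>* x y \<longrightarrow> (one_step A)\<^sup>*\<^sup>* x z \<longrightarrow> joinable A y z)"
proof (intro iffI ballI allI impI)
  fix x y z assume conf: "confluent A" and x: "x \<in> objs A"
    and "(one_step A)\<^sup>*\<^sup>* x y" "(one_step A)\<^sup>*\<^sup>* x z"
  then obtain r s where rs: "is_sequence A x r" "seq_target A (x, r) = y"
      "is_sequence A x s" "seq_target A (x, s) = z"
    using reach_is_sequence by meson
  then have "((x, r), (x, s)) \<in> branchings A" by (simp add: branchings_def finite_sequences_def)
  then have "confluent_branching A ((x, r), (x, s))" using conf by (simp add: confluent_def)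
  then show "joinable A y z"
    using confluent_branching_iff[of "((x, r), (x, s))"] is_sequence_reach rs
    by (metis fst_conv snd_conv)
next
  assume *: "\<forall>x\<in>objs A. \<forall>y z. (one_step A)\<^sup>*\<^sup>* x y \<longrightarrow> (one_step A)\<^sup>*\<^sup>* x z \<longrightarrow> joinable A y z"
  show "confluent A"
    unfolding confluent_def
  proof
    fix b assume "b \<in> branchings A"
    then obtain x r s where b: "b = ((x, r), (x, s))" "is_sequence A x r" "is_sequence A x s"
      by (auto simp: branchings_def finite_sequences_def)
    note r = is_sequence_reach[OF b(2)] and s = is_sequence_reach[OF b(3)]
    then have "joinable A (seq_target A (x, r)) (seq_target A (x, s))" using * by blast
    then show "confluent_branching A b"
      using confluent_branching_iff[of b] r s by (simp only: b fst_conv snd_conv)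
  qed
qed

lemma confluent_local_branching_iff:
  assumes "f \<in> steps A" "g \<in> steps A"
  shows "confluent_branching A (as_branching A (f, g)) \<longleftrightarrow> joinable A (target A f) (target A g)"
  using assms confluent_branching_iff[of "as_branching A (f, g)"] target_objs by simp

lemma locally_confluent_iff:
  "locally_confluent A \<longleftrightarrow> (\<forall>f\<in>steps A. \<forall>g\<in>steps A.
     source A f = source A g \<longrightarrow> joinable A (target A f) (target A g))"
  unfolding locally_confluent_def local_branchings_def
  using confluent_local_branching_iff by fastforce

end

text \<open>A raising operator changes exactly one letter of a word, and raises that letter.\<close>

lemma kop_words_depth:
  fixes d :: "'a \<Rightarrow> nat"
  assumes norm: "normal_strings \<Gamma>"
    and d: "\<And>x y i. x \<in> elts \<Gamma> \<Longrightarrow> ke \<Gamma> i x = Some y \<Longrightarrow> d y < d x"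
  shows "w \<in> lists (elts \<Gamma>) \<Longrightarrow> kop True (words \<Gamma>) i w = Some w' \<Longrightarrow>
    sum_list (map d w') < sum_list (map d w)"
proof (induction w arbitrary: w')
  case Nil
  then show ?case by (simp add: words_Nil)
next
  case (Cons x w)
  then have xw: "x \<in> elts \<Gamma>" "w \<in> lists (elts \<Gamma>)" by auto
  show ?case
    using Cons.prems(2) Cons.IH[OF xw(2)] d[OF xw(1)] unfolding words_Cons(3)[OF norm xw]
    by (auto simp: kop_def split: if_splits)
qed

text \<open>Associativity of the tensor product rule for five factors u, t, s, r, v: on the left
  they are bracketed as (u t)(s (r v)), on the right as u ((t (s r)) v). Prefixes \<open>p\<close>
  and \<open>e\<close> stand for \<open>phi\<close> and \<open>eps\<close>, and A, B, C, F, G are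
  the results of acting on the respective factors.\<close>

lemma acts_left_regroup:
  fixes pu pt et ps es pr er ev :: int
  shows "(if acts_left b (pt + max 0 (pu - et)) (es + max 0 ((er + max 0 (ev - pr)) - ps))
      then if acts_left b pu et then A else B
      else if acts_left b ps (er + max 0 (ev - pr)) then C
      else if acts_left b pr ev then F else G) =
    (if acts_left b pu (et + max 0 (es + max 0 ((er + max 0 (ev - pr)) - ps) - pt)) then A
     else if acts_left b ((pr + max 0 (ps - er)) + max 0 (pt - (es + max 0 (er - ps)))) ev
     then if acts_left b pt (es + max 0 (er - ps)) then B else if acts_left b ps er then C else F
     else G)"
  by (cases b) (simp_all add: acts_left_def)

text \<open>From here on the modules enter only through the depth function \<open>d\<close> on
  letters and the crystals through their string rules.\<close>

locale polygraph_with_strings =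
  fixes X :: "('i, 'r::finite, 'a, 'b) polygraph" and d :: "'a \<Rightarrow> nat"
  assumes norm1: "normal_strings (gen1 X)" and norm2: "normal_strings (gen2 X)"
    and src: "crystal_morphism (gen2 X) (words (gen1 X)) (src1 X)"
    and tgt: "crystal_morphism (gen2 X) (words (gen1 X)) (tgt1 X)"
    and depth: "\<And>x y i. x \<in> elts (gen1 X) \<Longrightarrow> ke (gen1 X) i x = Some y \<Longrightarrow> d y < d x"
begin

abbreviation W :: "('i, 'r, 'a list) crystal_data" where "W \<equiv> words (gen1 X)"

text \<open>The step \<open>t \<alpha> v\<close> is the element \<open>t \<otimes> (\<alpha> \<otimes> v)\<close>, so the Kashiwara operators on steps are those
  of this tensor product.\<close>

abbreviation T :: "('i, 'r, ('a, 'b) step) crystal_data" where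
  "T \<equiv> tensor W (tensor (gen2 X) W)"

abbreviation R where "R \<equiv> rewriting X"
abbreviation H where "H \<equiv> hw_rewriting X"

lemma norm_W: "normal_strings W"
  using words_normal_strings norm1 .

lemma norm_G2W: "normal_strings (tensor (gen2 X) W)"
  using tensor_normal_strings(1) norm2 norm_W .

lemma norm_T: "normal_strings T"
  using tensor_normal_strings(1) norm_W norm_G2W .

lemma elts_T: "elts T = Step X"
  by (simp add: tensor_def Let_def Step_def)

lemma elts_W: "elts W = lists (elts (gen1 X))"
  by (rule elts_words)

lemma append_W [simp]: "u @ v \<in> elts W \<longleftrightarrow> u \<in> elts W \<and> v \<in> elts W"
  by (auto simp: elts_W)

lemma Nil_W [simp]: "[] \<in> elts W"
  by (simp add: elts_W)

lemmas W_append = words_append[OF norm1, folded elts_W] kop_append[OF norm1, folded elts_W]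

lemma morphismD:
  assumes "crystal_morphism (gen2 X) W s" "\<alpha> \<in> elts (gen2 X)"
  shows "s \<alpha> \<in> elts W" "eps W i (s \<alpha>) = eps (gen2 X) i \<alpha>" "phi W i (s \<alpha>) = phi (gen2 X) i \<alpha>"
    "kop b W i (s \<alpha>) = map_option s (kop b (gen2 X) i \<alpha>)"
  using assms by (auto simp: crystal_morphism_def kop_def)

lemma kop_T:
  assumes "\<alpha> \<in> elts (gen2 X)" "v \<in> elts W"
  shows "kop b T i (t, \<alpha>, v) =
    (if acts_left b (phi W i t) (eps (gen2 X) i \<alpha> + max 0 (eps W i v - phi (gen2 X) i \<alpha>))
     then map_option (\<lambda>t'. (t', \<alpha>, v)) (kop b W i t)
     else if acts_left b (phi (gen2 X) i \<alpha>) (eps W i v)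
     then map_option (\<lambda>\<alpha>'. (t, \<alpha>', v)) (kop b (gen2 X) i \<alpha>)
     else map_option (\<lambda>v'. (t, \<alpha>, v')) (kop b W i v))"
  by (simp add: kop_tensor tensor_normal_strings(2)[OF norm2 norm_W assms] option.map_comp comp_def)

text \<open>A morphism preserves \<open>eps\<close> and \<open>phi\<close>, so the tensor product
  rule selects the same factor in the word as in the step. Source and target are the two
  instances.\<close>

lemma kop_substitute:
  assumes s: "crystal_morphism (gen2 X) W s" and \<gamma>: "(t, \<alpha>, v) \<in> Step X"
  shows "kop b W i (t @ s \<alpha> @ v) = map_option (\<lambda>(t, \<alpha>, v). t @ s \<alpha> @ v) (kop b T i (t, \<alpha>, v))"
proof -
  have \<gamma>': "t \<in> elts W" "\<alpha> \<in> elts (gen2 X)" "v \<in> elts W" using \<gamma> by (auto simp: Step_def)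
  note s' = morphismD[OF s \<gamma>'(2)]
  show ?thesis
    using \<gamma>' s'(1)
    by (simp add: W_append kop_T s'(2-4) option.map_comp comp_def)
qed

lemma kop_source:
  assumes "\<gamma> \<in> Step X"
  shows "kop b W i (step_source X \<gamma>) = map_option (step_source X) (kop b T i \<gamma>)"
proof -
  obtain t \<alpha> v where \<gamma>: "\<gamma> = (t, \<alpha>, v)" by (cases \<gamma>)
  have "step_source X = (\<lambda>(t, \<alpha>, v). t @ src1 X \<alpha> @ v)" by auto
  then show ?thesis using kop_substitute[OF src, of t \<alpha> v b i] assms \<gamma> by simp
qed

lemma kop_target:
  assumes "\<gamma> \<in> Step X"
  shows "kop b W i (step_target X \<gamma>) = map_option (step_target X) (kop b T i \<gamma>)"
proof -
  obtain t \<alpha> v where \<gamma>: "\<gamma> = (t, \<alpha>, v)" by (cases \<gamma>)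
  have "step_target X = (\<lambda>(t, \<alpha>, v). t @ tgt1 X \<alpha> @ v)" by auto
  then show ?thesis using kop_substitute[OF tgt, of t \<alpha> v b i] assms \<gamma> by simp
qed

lemma kop_W_length: "w \<in> elts W \<Longrightarrow> kop b W i w = Some w' \<Longrightarrow> length w' = length w"
  using kop_words_length[OF norm1] by (simp add: elts_W)

text \<open>\<open>step_op\<close> recognizes the affected factor by comparing words. This is
  unambiguous: an operator changes a factor without changing its length, so altering two different
  factors never gives the same word.\<close>

lemma step_op_eq_kop:
  assumes "\<gamma> \<in> Step X"
  shows "step_op (kop b W i) (kop b (gen2 X) i) (src1 X) \<gamma> = kop b T i \<gamma>"
proof -
  obtain t \<alpha> v where \<gamma>: "\<gamma> = (t, \<alpha>, v)" by (cases \<gamma>)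
  have mem: "t \<in> elts W" "\<alpha> \<in> elts (gen2 X)" "v \<in> elts W" using assms by (auto simp: \<gamma> Step_def)
  note s = morphismD[OF src mem(2)]
  have move: "u' \<noteq> u" "length u' = length u" if "u \<in> elts W" "kop b W i u = Some u'" for u u'
    using kop_closed(3)[OF norm_W that] kop_W_length[OF that] by auto
  have eq: "kop b W i (t @ src1 X \<alpha> @ v) = map_option (\<lambda>(t, \<alpha>, v). t @ src1 X \<alpha> @ v) (kop b T i \<gamma>)"
    using kop_substitute[OF src] assms \<gamma> by simp
  show ?thesis
  proof (cases "kop b T i \<gamma>")
    case None
    then show ?thesis using eq by (simp add: \<gamma>)
  next
    case (Some \<gamma>')
    consider
        t' where "\<gamma>' = (t', \<alpha>, v)" "kop b W i t = Some t'"
      | \<alpha>' where "\<gamma>' = (t, \<alpha>', v)" "kop b (gen2 X) i \<alpha> = Some \<alpha>'"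
      | v' where "\<gamma>' = (t, \<alpha>, v')" "kop b W i v = Some v'"
      using Some unfolding \<gamma> kop_T[OF mem(2,3)] by (auto split: if_splits)
    then show ?thesis
    proof cases
      case 1
      then show ?thesis using eq Some by (simp add: \<gamma>)
    next
      case 2
      have s': "kop b W i (src1 X \<alpha>) = Some (src1 X \<alpha>')" using s(4) 2 by simp
      have "t @ src1 X \<alpha>' @ v \<noteq> t' @ src1 X \<alpha> @ v" if "kop b W i t = Some t'" for t'
        using move[OF mem(1) that] by (metis append_eq_append_conv)
      then show ?thesis using eq Some 2 s' by (auto simp: \<gamma>)
    next
      case 3
      have "t @ src1 X \<alpha> @ v' \<noteq> t' @ src1 X \<alpha> @ v" if "kop b W i t = Some t'" for t'
        using move[OF mem(1) that] by (metis append_eq_append_conv)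
      moreover have "v' \<noteq> v" using move[OF mem(3) 3(2)] by simp
      moreover have "src1 X \<alpha> @ v' \<noteq> s' @ v" if "kop b W i (src1 X \<alpha>) = Some s'" for s'
        using move[OF s(1) that] by (metis append_eq_append_conv)
      ultimately show ?thesis using eq Some 3 by (auto simp: \<gamma>)
    qed
  qed
qed

section \<open>Highest weight words, highest weight steps and transport of sequences\<close>

lemma highest_weight_W:
  "w \<in> highest_weight_elts W \<longleftrightarrow> w \<in> elts W \<and> (\<forall>i. kop True W i w = None)"
  by (simp add: highest_weight_elts_def kop_def)

lemma source_W: "\<gamma> \<in> Step X \<Longrightarrow> step_source X \<gamma> \<in> elts W"
  using morphismD(1)[OF src] by (auto simp: Step_def)

text \<open>By \<open>kop_source\<close> a raising operator is defined on a step exactly when it is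
  defined on the source.\<close>

lemma highest_weight_steps:
  "\<gamma> \<in> highest_weight_elts (step_crystal X) \<longleftrightarrow>
     \<gamma> \<in> Step X \<and> step_source X \<gamma> \<in> highest_weight_elts W"
proof (cases "\<gamma> \<in> Step X")
  case True
  have "ke (step_crystal X) i \<gamma> = None \<longleftrightarrow> kop True W i (step_source X \<gamma>) = None" for i
    using step_op_eq_kop[OF True, of True i] kop_source[OF True, of True i]
    by (simp add: step_crystal_def Let_def kop_def)
  then show ?thesis
    using True source_W[OF True] by (auto simp: highest_weight_W) (simp_all add: highest_weight_elts_def step_crystal_def Let_def)
qed (simp add: highest_weight_elts_def step_crystal_def Let_def)

lemma target_W: "\<gamma> \<in> Step X \<Longrightarrow> step_target X \<gamma> \<in> elts W"
  using morphismD(1)[OF tgt] by (auto simp: Step_def)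

lemma highest_weight_target:
  assumes "\<gamma> \<in> Step X" "step_source X \<gamma> \<in> highest_weight_elts W"
  shows "step_target X \<gamma> \<in> highest_weight_elts W"
  using assms kop_source[OF assms(1)] kop_target[OF assms(1)] target_W by (auto simp: highest_weight_W)

sublocale R: ars R
  by standard (use source_W target_W in \<open>auto simp: rewriting_def\<close>)

sublocale H: ars H
  by standard (use highest_weight_target highest_weight_steps in \<open>auto simp: hw_rewriting_def\<close>)

lemma one_step_R: "one_step R x y \<longleftrightarrow> (\<exists>\<gamma>\<in>Step X. step_source X \<gamma> = x \<and> step_target X \<gamma> = y)"
  by (simp add: one_step_def rewriting_def)

lemma one_step_H: "one_step H x y \<longleftrightarrow> x \<in> highest_weight_elts W \<and> one_step R x y"
  unfolding one_step_R by (auto simp: one_step_def hw_rewriting_def highest_weight_steps)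

text \<open>Rewriting never leaves the highest weight words, so restricting the steps loses nothing
  when starting from one of them.\<close>

lemma reach_H:
  assumes "x \<in> highest_weight_elts W"
  shows "(one_step H)\<^sup>*\<^sup>* x y \<longleftrightarrow> (one_step R)\<^sup>*\<^sup>* x y"
proof
  show "(one_step R)\<^sup>*\<^sup>* x y" if "(one_step H)\<^sup>*\<^sup>* x y"
    using that by (rule rtranclp_mono[THEN predicate2D, rotated]) (auto simp: one_step_H)
  assume "(one_step R)\<^sup>*\<^sup>* x y"
  then have "(one_step H)\<^sup>*\<^sup>* x y \<and> y \<in> highest_weight_elts W"
  proof induction
    case (step y z)
    then have "one_step H y z" "z \<in> highest_weight_elts W"
      using highest_weight_target by (auto simp: one_step_H one_step_R)
    then show ?case using step by (meson rtranclp.rtrancl_into_rtrancl)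
  qed (use assms in simp)
  then show "(one_step H)\<^sup>*\<^sup>* x y" ..
qed

lemma joinable_H:
  assumes "y \<in> highest_weight_elts W" "z \<in> highest_weight_elts W"
  shows "joinable H y z \<longleftrightarrow> joinable R y z"
  by (simp add: joinable_def reach_H assms)

lemma reach_kop:
  assumes "(one_step R)\<^sup>*\<^sup>* x y" "kop b W i x = Some x'"
  shows "\<exists>y'. kop b W i y = Some y' \<and> (one_step R)\<^sup>*\<^sup>* x' y'"
  using assms(1)
proof induction
  case base
  then show ?case using assms(2) by simp
next
  case (step y z)
  then obtain y' where y': "kop b W i y = Some y'" "(one_step R)\<^sup>*\<^sup>* x' y'" by auto
  obtain \<gamma> where \<gamma>: "\<gamma> \<in> Step X" "step_source X \<gamma> = y" "step_target X \<gamma> = z"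
    using step(2) by (auto simp: one_step_R)
  \<comment> \<open>The operator is defined on the source \<open>y\<close>, hence on the step, hence
    on its target \<open>z\<close>.\<close>
  obtain \<gamma>' where \<gamma>': "kop b T i \<gamma> = Some \<gamma>'" "step_source X \<gamma>' = y'"
    using kop_source[OF \<gamma>(1), of b i] y'(1) by (cases "kop b T i \<gamma>") (simp_all add: \<gamma>(2))
  have "\<gamma>' \<in> Step X" using kop_closed(1)[OF norm_T, unfolded elts_T] \<gamma>(1) \<gamma>'(1) .
  then have "one_step R y' (step_target X \<gamma>')" using \<gamma>' by (auto simp: one_step_R)
  moreover have "kop b W i z = Some (step_target X \<gamma>')"
    using kop_target[OF \<gamma>(1), of b i] \<gamma> \<gamma>' by simp
  ultimately show ?case using y'(2) by (auto intro: rtranclp.rtrancl_into_rtrancl)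
qed

lemma joinable_kop:
  assumes "joinable R y z" "kop b W i y = Some y'" "kop b W i z = Some z'"
  shows "joinable R y' z'"
proof -
  obtain w where "(one_step R)\<^sup>*\<^sup>* y w" "(one_step R)\<^sup>*\<^sup>* z w" using assms(1) by (auto simp: joinable_def)
  then show ?thesis
    using reach_kop assms(2,3) unfolding joinable_def by (metis option.inject)
qed

text \<open>Lowering with the same index undoes the raising, and joinability is transported along
  it.\<close>

lemma joinable_ke:
  assumes "joinable R y' z'" "y \<in> elts W" "z \<in> elts W"
    and "kop True W i y = Some y'" "kop True W i z = Some z'"
  shows "joinable R y z"
  using joinable_kop[OF assms(1), of False i y z] assms(2-5) kop_closed(2)[OF norm_W, where b=True]
  by simp

text \<open>Induction on the total depth of the letters. It reduces each of the four properties to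
  highest weight words and a single raising.\<close>

lemma highest_weight_induct [consumes 1, case_names highest raise]:
  assumes "w \<in> elts W" "\<And>w. w \<in> highest_weight_elts W \<Longrightarrow> P w"
    and "\<And>w i w'. w \<in> elts W \<Longrightarrow> kop True W i w = Some w' \<Longrightarrow> P w' \<Longrightarrow> P w"
  shows "P w"
  using assms(1)
proof (induction "sum_list (map d w)" arbitrary: w rule: less_induct)
  case less
  show ?case
  proof (cases "w \<in> highest_weight_elts W")
    case False
    then obtain i w' where w': "kop True W i w = Some w'"
      using less(2) by (auto simp: highest_weight_W)
    have "sum_list (map d w') < sum_list (map d w)"
      using kop_words_depth[OF norm1 depth _ w'] less(2) by (simp add: elts_W)
    then show ?thesis
      using less(1) kop_closed(1)[OF norm_W less(2) w'] assms(3)[OF less(2) w'] by simp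
  qed (rule assms(2))
qed

lemma terminating_iff: "terminating R \<longleftrightarrow> terminating H"
proof
  show "terminating H" if "terminating R"
    using that unfolding terminating_def
    by (simp add: rewriting_def hw_rewriting_def highest_weight_steps) blast
  assume H: "terminating H"
  \<comment> \<open>Termination is localized at the initial word. The sequence is quantified inside
    because raising replaces it by another one, starting at the raised word.\<close>
  have "\<forall>\<sigma>. (\<forall>n. \<sigma> n \<in> Step X \<and> step_target X (\<sigma> n) = step_source X (\<sigma> (Suc n))) \<longrightarrow>
      step_source X (\<sigma> 0) \<noteq> w" if "w \<in> elts W" for w
    using that
  proof (induction rule: highest_weight_induct)
    case (highest w)
    show ?case
    proof (intro allI impI notI)
      fix \<sigma> assume "\<forall>n. \<sigma> n \<in> Step X \<and> step_target X (\<sigma> n) = step_source X (\<sigma> (Suc n))"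
        and "step_source X (\<sigma> 0) = w"
      then have \<sigma>: "\<And>n. \<sigma> n \<in> Step X" "step_source X (\<sigma> 0) = w"
        "\<And>n. step_target X (\<sigma> n) = step_source X (\<sigma> (Suc n))"
        by simp_all
      have "step_source X (\<sigma> n) \<in> highest_weight_elts W" for n
        by (induction n) (use highest \<sigma>(2) highest_weight_target[OF \<sigma>(1)] \<sigma>(3) in auto)
      then have "\<forall>n. \<sigma> n \<in> steps H \<and> target H (\<sigma> n) = source H (\<sigma> (Suc n))"
        using \<sigma> by (simp add: hw_rewriting_def highest_weight_steps)
      then show False using H unfolding terminating_def by (elim notE) (rule exI)
    qed
  next
    case (raise w i w')
    show ?case
    proof (intro allI impI notI)
      fix \<sigma> assume "\<forall>n. \<sigma> n \<in> Step X \<and> step_target X (\<sigma> n) = step_source X (\<sigma> (Suc n))"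
        and "step_source X (\<sigma> 0) = w"
      then have \<sigma>: "\<And>n. \<sigma> n \<in> Step X" "step_source X (\<sigma> 0) = w"
        "\<And>n. step_target X (\<sigma> n) = step_source X (\<sigma> (Suc n))"
        by simp_all
      \<comment> \<open>Definedness spreads along the sequence: from a step to its target, which is
        the next source, and from there to the next step.\<close>
      have "kop True T i (\<sigma> n) \<noteq> None" for n
      proof (induction n)
        case 0
        then show ?case
          using kop_source[OF \<sigma>(1), of True i 0] raise(2) \<sigma>(2)
          by (cases "kop True T i (\<sigma> 0)") simp_all
      next
        case (Suc n)
        then show ?case
          using kop_source[OF \<sigma>(1), of True i "Suc n"] kop_target[OF \<sigma>(1), of True i n] \<sigma>(3)[of n]
          by (cases "kop True T i (\<sigma> (Suc n))") simp_all
      qed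
      then have "\<forall>n. \<exists>\<gamma>. kop True T i (\<sigma> n) = Some \<gamma>" by blast
      then obtain \<tau> where \<tau>: "\<And>n. kop True T i (\<sigma> n) = Some (\<tau> n)"
        by (elim choice[THEN exE]) simp
      have "\<tau> n \<in> Step X" for n
        using kop_closed(1)[OF norm_T, unfolded elts_T] \<sigma>(1) \<tau> .
      moreover have "step_target X (\<tau> n) = step_source X (\<tau> (Suc n))" for n
        using kop_source[OF \<sigma>(1), of True i "Suc n"] kop_target[OF \<sigma>(1), of True i n] \<sigma>(3)[of n] \<tau>
        by simp
      moreover have "step_source X (\<tau> 0) = w'"
        using kop_source[OF \<sigma>(1), of True i 0] raise(2) \<sigma>(2) \<tau> by simp
      ultimately show False using raise(3)[THEN spec, of \<tau>] by simp
    qed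
  qed
  then show "terminating R"
    unfolding terminating_def
    by (intro notI, elim exE) (use source_W in \<open>fastforce simp: rewriting_def\<close>)
qed

lemma objs_R: "objs R = elts W" and objs_H: "objs H = highest_weight_elts W"
  by (simp_all add: rewriting_def hw_rewriting_def)

lemma steps_R: "steps R = Step X" "source R = step_source X" "target R = step_target X"
  by (simp_all add: rewriting_def)

lemma steps_H:
  "\<gamma> \<in> steps H \<longleftrightarrow> \<gamma> \<in> Step X \<and> step_source X \<gamma> \<in> highest_weight_elts W"
  "source H = step_source X" "target H = step_target X"
  by (simp_all add: hw_rewriting_def highest_weight_steps)

lemma one_step_highest_weight:
  "one_step R x y \<Longrightarrow> x \<in> highest_weight_elts W \<Longrightarrow> y \<in> highest_weight_elts W"
  unfolding one_step_R using highest_weight_target by blast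

lemma one_step_elts: "one_step R x y \<Longrightarrow> y \<in> elts W"
  unfolding one_step_R using target_W by blast

lemma reach_highest_weight:
  assumes "(one_step R)\<^sup>*\<^sup>* x y" "x \<in> highest_weight_elts W"
  shows "y \<in> highest_weight_elts W"
  using assms(1)
  by induction (use assms(2) one_step_highest_weight in blast)+

lemma reach_elts:
  assumes "(one_step R)\<^sup>*\<^sup>* x y" "x \<in> elts W"
  shows "y \<in> elts W"
  using assms(1)
  by induction (use assms(2) one_step_elts in blast)+

text \<open>In the raising case both arms of a peak are transported to the raised word, joined
  there, and the join is lowered again.\<close>

lemma confluent_iff_highest_weight: "confluent R \<longleftrightarrow> confluent H"
proof
  show "confluent H" if "confluent R"
    unfolding H.confluent_iff objs_H
  proof (intro ballI allI impI)
    fix x y z assume x: "x \<in> highest_weight_elts W"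
      and "(one_step H)\<^sup>*\<^sup>* x y" "(one_step H)\<^sup>*\<^sup>* x z"
    then have yz: "(one_step R)\<^sup>*\<^sup>* x y" "(one_step R)\<^sup>*\<^sup>* x z" by (simp_all add: reach_H)
    have "x \<in> elts W" using x by (simp add: highest_weight_W)
    then have "joinable R y z" using that yz unfolding R.confluent_iff objs_R by blast
    then show "joinable H y z" using joinable_H reach_highest_weight x yz by blast
  qed
  assume H: "confluent H"
  have "\<forall>y z. (one_step R)\<^sup>*\<^sup>* x y \<longrightarrow> (one_step R)\<^sup>*\<^sup>* x z \<longrightarrow> joinable R y z" if "x \<in> elts W" for x
    using that
  proof (induction rule: highest_weight_induct)
    case (highest x)
    show ?case
    proof (intro allI impI)
      fix y z assume yz: "(one_step R)\<^sup>*\<^sup>* x y" "(one_step R)\<^sup>*\<^sup>* x z"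
      then have "joinable H y z"
        using H highest unfolding H.confluent_iff objs_H by (auto simp: reach_H)
      then show "joinable R y z" using joinable_H reach_highest_weight highest yz by blast
    qed
  next
    case (raise x i x')
    show ?case
    proof (intro allI impI)
      fix y z assume yz: "(one_step R)\<^sup>*\<^sup>* x y" "(one_step R)\<^sup>*\<^sup>* x z"
      then obtain y' z' where y': "kop True W i y = Some y'" "(one_step R)\<^sup>*\<^sup>* x' y'"
        and z': "kop True W i z = Some z'" "(one_step R)\<^sup>*\<^sup>* x' z'"
        using reach_kop raise(2) by metis
      have "y \<in> elts W" "z \<in> elts W" using reach_elts raise(1) yz by auto
      then show "joinable R y z" using joinable_ke y' z' raise(3) by blast
    qed
  qed
  then show "confluent R" unfolding R.confluent_iff objs_R by blast
qed

text \<open>The two steps share their source, so an operator defined on it is defined on both steps,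
  and the results again share a source.\<close>

lemma kop_local_branching:
  assumes "f \<in> Step X" "g \<in> Step X" "step_source X f = step_source X g"
    and "kop b W i (step_source X f) = Some w"
  obtains f' g' where "kop b T i f = Some f'" "kop b T i g = Some g'" "f' \<in> Step X" "g' \<in> Step X"
    "step_source X f' = w" "step_source X g' = w"
    "kop b W i (step_target X f) = Some (step_target X f')"
    "kop b W i (step_target X g) = Some (step_target X g')"
proof -
  obtain f' g' where fg: "kop b T i f = Some f'" "kop b T i g = Some g'"
    "step_source X f' = w" "step_source X g' = w"
    using kop_source[OF assms(1), of b i] kop_source[OF assms(2), of b i] assms(3,4)
    by (cases "kop b T i f"; cases "kop b T i g") simp_all
  show ?thesis
    using that[OF fg(1,2) _ _ fg(3,4)] fg(1,2) kop_target[OF assms(1), of b i] kop_target[OF assms(2), of b i]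
      kop_closed(1)[OF norm_T, unfolded elts_T, OF assms(1)]
      kop_closed(1)[OF norm_T, unfolded elts_T, OF assms(2)]
    by simp
qed

text \<open>Local confluence and confluence of critical branchings are the instances \<open>B = UNIV\<close> and
  \<open>B = Crit X\<close>.\<close>

lemma joinable_branchings_iff:
  assumes "\<And>f g b i f' g'. (f, g) \<in> B \<Longrightarrow> f \<in> Step X \<Longrightarrow> g \<in> Step X \<Longrightarrow>
      step_source X f = step_source X g \<Longrightarrow> kop b T i f = Some f' \<Longrightarrow> kop b T i g = Some g' \<Longrightarrow>
      (f', g') \<in> B"
  shows "(\<forall>f\<in>steps R. \<forall>g\<in>steps R. source R f = source R g \<longrightarrow> (f, g) \<in> B \<longrightarrow>
      joinable R (target R f) (target R g)) \<longleftrightarrow>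
    (\<forall>f\<in>steps H. \<forall>g\<in>steps H. source H f = source H g \<longrightarrow> (f, g) \<in> B \<longrightarrow>
      joinable H (target H f) (target H g))"
proof (intro iffI ballI impI)
  fix f g
  assume *: "\<forall>f\<in>steps R. \<forall>g\<in>steps R. source R f = source R g \<longrightarrow> (f, g) \<in> B \<longrightarrow>
      joinable R (target R f) (target R g)"
    and "f \<in> steps H" "g \<in> steps H" "source H f = source H g" "(f, g) \<in> B"
  then show "joinable H (target H f) (target H g)"
    using joinable_H highest_weight_target by (simp add: steps_R steps_H)
next
  assume *: "\<forall>f\<in>steps H. \<forall>g\<in>steps H. source H f = source H g \<longrightarrow> (f, g) \<in> B \<longrightarrow>
      joinable H (target H f) (target H g)"
  have "\<forall>f\<in>Step X. \<forall>g\<in>Step X. step_source X f = w \<longrightarrow> step_source X g = w \<longrightarrow> (f, g) \<in> B \<longrightarrow>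
      joinable R (step_target X f) (step_target X g)" if "w \<in> elts W" for w
    using that
  proof (induction rule: highest_weight_induct)
    case (highest w)
    show ?case
    proof (intro ballI impI)
      fix f g assume fg: "f \<in> Step X" "g \<in> Step X" "step_source X f = w" "step_source X g = w" "(f, g) \<in> B"
      then have "joinable H (step_target X f) (step_target X g)"
        using * highest by (simp add: steps_H)
      then show "joinable R (step_target X f) (step_target X g)"
        using joinable_H highest_weight_target fg highest by simp
    qed
  next
    case (raise w i w')
    show ?case
    proof (intro ballI impI)
      fix f g assume fg: "f \<in> Step X" "g \<in> Step X" "step_source X f = w" "step_source X g = w" "(f, g) \<in> B"
      obtain f' g' where fg': "kop True T i f = Some f'" "kop True T i g = Some g'"
        "f' \<in> Step X" "g' \<in> Step X" "step_source X f' = w'" "step_source X g' = w'"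
        "kop True W i (step_target X f) = Some (step_target X f')"
        "kop True W i (step_target X g) = Some (step_target X g')"
        using kop_local_branching[of f g True i w'] fg raise(2) by metis
      \<comment> \<open>Closure of \<open>B\<close> under the operators keeps the raised branching
        within the reach of the induction hypothesis.\<close>
      have "(f', g') \<in> B" using assms[OF fg(5,1,2) _ fg'(1,2)] fg(3,4) by simp
      then have "joinable R (step_target X f') (step_target X g')" using raise(3) fg' by blast
      then show "joinable R (step_target X f) (step_target X g)"
        using joinable_ke fg' target_W fg(1,2) by blast
    qed
  qed
  then show "joinable R (target R f) (target R g)"
    if "f \<in> steps R" "g \<in> steps R" "source R f = source R g" "(f, g) \<in> B" for f g
    using that source_W[of f] unfolding steps_R by metis
qed

lemma locally_confluent_iff_highest_weight: "locally_confluent R \<longleftrightarrow> locally_confluent H"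
  unfolding R.locally_confluent_iff H.locally_confluent_iff
  using joinable_branchings_iff[of UNIV] by simp

section \<open>Steps in context, Peiffer branchings and critical branchings\<close>

lemma kop_whisker:
  assumes u: "u \<in> elts W" and \<gamma>: "\<gamma> \<in> Step X" and v: "v \<in> elts W"
  shows "kop b T i (whisker u \<gamma> v) =
    (if acts_left b (phi W i u) (eps W i (step_source X \<gamma> @ v))
     then map_option (\<lambda>u'. whisker u' \<gamma> v) (kop b W i u)
     else if acts_left b (phi W i (step_source X \<gamma>)) (eps W i v)
     then map_option (\<lambda>\<gamma>'. whisker u \<gamma>' v) (kop b T i \<gamma>)
     else map_option (\<lambda>v'. whisker u \<gamma> v') (kop b W i v))"
proof -
  obtain t \<alpha> r where g: "\<gamma> = (t, \<alpha>, r)" by (cases \<gamma>)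
  have mem: "t \<in> elts W" "\<alpha> \<in> elts (gen2 X)" "r \<in> elts W" using \<gamma> by (auto simp: g Step_def)
  note s = morphismD[OF src mem(2)]
  have tr: "src1 X \<alpha> @ r \<in> elts W" "r @ v \<in> elts W" "src1 X \<alpha> @ r @ v \<in> elts W"
    using mem v s(1) by simp_all
  have eta: "whisker u (t, \<alpha>, r) = (\<lambda>v'. (u @ t, \<alpha>, r @ v'))"
    by (rule ext) simp
  let ?u = "map_option (\<lambda>u'. (u' @ t, \<alpha>, r @ v)) (kop b W i u)"
  let ?t = "map_option (\<lambda>t'. (u @ t', \<alpha>, r @ v)) (kop b W i t)"
  let ?\<alpha> = "map_option (\<lambda>\<alpha>'. (u @ t, \<alpha>', r @ v)) (kop b (gen2 X) i \<alpha>)"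
  let ?r = "map_option (\<lambda>r'. (u @ t, \<alpha>, r' @ v)) (kop b W i r)"
  let ?v = "map_option (\<lambda>v'. (u @ t, \<alpha>, r @ v')) (kop b W i v)"
  let ?es = "eps (gen2 X) i \<alpha>" and ?ps = "phi (gen2 X) i \<alpha>"
  let ?rv = "eps W i r + max 0 (eps W i v - phi W i r)"
  \<comment> \<open>The definition of the whiskered step brackets \<open>u\<close> with
    \<open>t\<close> and \<open>r\<close> with \<open>v\<close>. Regrouping puts the original step
    back together between the two contexts, with the \<open>eps\<close> and \<open>phi\<close> of
    its source.\<close>
  have "kop b T i (whisker u \<gamma> v) =
    (if acts_left b (phi W i t + max 0 (phi W i u - eps W i t)) (?es + max 0 (?rv - ?ps))
     then if acts_left b (phi W i u) (eps W i t) then ?u else ?t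
     else if acts_left b ?ps ?rv then ?\<alpha>
     else if acts_left b (phi W i r) (eps W i v) then ?r else ?v)"
    by (simp add: g kop_T[OF mem(2) tr(2)] W_append(1)[OF mem(1) u] W_append(1)[OF v mem(3)]
      W_append(2)[OF mem(1) u] W_append(2)[OF v mem(3)] option.map_comp comp_def)
  also have "\<dots> =
    (if acts_left b (phi W i u) (eps W i t + max 0 (?es + max 0 (?rv - ?ps) - phi W i t)) then ?u
     else if acts_left b ((phi W i r + max 0 (?ps - eps W i r))
         + max 0 (phi W i t - (?es + max 0 (eps W i r - ?ps)))) (eps W i v)
     then if acts_left b (phi W i t) (?es + max 0 (eps W i r - ?ps)) then ?t
       else if acts_left b ?ps (eps W i r) then ?\<alpha> else ?r
     else ?v)"
    by (rule acts_left_regroup)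
  also have "\<dots> = (if acts_left b (phi W i u) (eps W i (step_source X \<gamma> @ v))
     then map_option (\<lambda>u'. whisker u' \<gamma> v) (kop b W i u)
     else if acts_left b (phi W i (step_source X \<gamma>)) (eps W i v)
     then map_option (\<lambda>\<gamma>'. whisker u \<gamma>' v) (kop b T i \<gamma>)
     else map_option (\<lambda>v'. whisker u \<gamma> v') (kop b W i v))"
    by (simp add: eta g kop_T[OF mem(2,3)] W_append(1)[OF tr(3) mem(1)] W_append(1)[OF tr(1) mem(1)]
      W_append(1)[OF tr(2) s(1)] W_append(1)[OF mem(3) s(1)] W_append(1)[OF v mem(3)]
      s(2,3) option.map_comp comp_def)
  finally show ?thesis .
qed

text \<open>Both steps of a Peiffer branching compare the same \<open>phi\<close> and
  \<open>eps\<close>, those of the two adjacent sources. So the operator acts on the same half in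
  both: as a step in one entry and as a source word in the other.\<close>

lemma peiffer_kop:
  assumes "peiffer X (f, g)" "kop b T i f = Some f'" "kop b T i g = Some g'"
  shows "peiffer X (f', g')"
proof -
  have *: "peiffer X (f', g') \<and> peiffer X (g', f')"
    if p: "p \<in> Step X" and q: "q \<in> Step X"
      and f': "kop b T i (whisker [] p (step_source X q)) = Some f'"
      and g': "kop b T i (whisker (step_source X p) q []) = Some g'" for p q f' g'
  proof -
    have peiffer: "peiffer X (x, y) \<and> peiffer X (y, x)"
      if "p \<in> Step X" "q \<in> Step X" "x = whisker [] p (step_source X q)" "y = whisker (step_source X p) q []" for p q x y
      using that unfolding peiffer_def Let_def by blast
    note sp = source_W[OF p] and sq = source_W[OF q]
    \<comment> \<open>No operator is defined on an empty context, so the cases in which it would act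
      there contradict definedness of the result.\<close>
    note F = f'[unfolded kop_whisker[OF Nil_W p sq] words_Nil]
    note G = g'[unfolded kop_whisker[OF sp q Nil_W] words_Nil append_Nil2]
    have nn: "0 \<le> phi W i (step_source X q)" using eps_phi_nonneg[OF norm_W sq] by simp
    show ?thesis
    proof (cases "acts_left b (phi W i (step_source X p)) (eps W i (step_source X q))")
      case True
      then obtain p' where p': "kop b T i p = Some p'" "f' = whisker [] p' (step_source X q)"
        using F by (auto split: if_splits)
      moreover have "kop b W i (step_source X p) = Some (step_source X p')"
        using kop_source[OF p, of b i] p' by simp
      then have "g' = whisker (step_source X p') q []" using True G by simp
      moreover have "p' \<in> Step X" using kop_closed(1)[OF norm_T, unfolded elts_T] p p'(1) .
      ultimately show ?thesis using peiffer q by blast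
    next
      case False
      then obtain q' where q': "kop b T i q = Some q'" "g' = whisker (step_source X p) q' []"
        using G by (auto split: if_splits)
      moreover have "kop b W i (step_source X q) = Some (step_source X q')"
        using kop_source[OF q, of b i] q' by simp
      then have "f' = whisker [] p (step_source X q')" using False F by (auto split: if_splits)
      moreover have "q' \<in> Step X" using kop_closed(1)[OF norm_T, unfolded elts_T] q q'(1) .
      ultimately show ?thesis using peiffer p by blast
    qed
  qed
  obtain p q where "p \<in> Step X" "q \<in> Step X"
    "f = whisker [] p (step_source X q) \<and> g = whisker (step_source X p) q [] \<or>
     g = whisker [] p (step_source X q) \<and> f = whisker (step_source X p) q []"
    using assms(1) unfolding peiffer_def Let_def by auto
  then show ?thesis using * assms(2,3) by blast
qed

text \<open>The tensor product rule sees a step only through its source, which \<open>p\<close> and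
  \<open>q\<close> share. Hence both entries change in the same factor: the left context, the middle
  or the right context.\<close>

lemma whiskered_branching_kop:
  assumes "u \<in> elts W" "v \<in> elts W" "p \<in> Step X" "q \<in> Step X" "step_source X p = step_source X q"
    and f: "kop b T i (whisker u p v) = Some f" and g: "kop b T i (whisker u q v) = Some g"
  obtains u' v' p' q' where "u' \<in> elts W" "v' \<in> elts W" "p' \<in> Step X" "q' \<in> Step X"
    "step_source X p' = step_source X q'" "f = whisker u' p' v'" "g = whisker u' q' v'"
    "length u' = length u" "length v' = length v"
proof -
  note F = f[unfolded kop_whisker[OF assms(1,3,2)]]
  note G = g[unfolded kop_whisker[OF assms(1,4,2)], folded assms(5)]
  consider
      u' where "kop b W i u = Some u'" "f = whisker u' p v" "g = whisker u' q v"
    | p' q' where "kop b T i p = Some p'" "kop b T i q = Some q'" "f = whisker u p' v" "g = whisker u q' v"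
    | v' where "kop b W i v = Some v'" "f = whisker u p v'" "g = whisker u q v'"
    using F G by (auto split: if_splits)
  then show ?thesis
  proof cases
    case 1
    then show ?thesis
      using that[of u' v p q] assms(1-5) kop_closed(1)[OF norm_W assms(1)] kop_W_length[OF assms(1)] by simp
  next
    case 2
    have "step_source X p' = step_source X q'"
      using kop_source[OF assms(3), of b i] kop_source[OF assms(4), of b i] assms(5) 2 by simp
    then show ?thesis
      using that[of u v p' q'] assms(1-5) 2 kop_closed(1)[OF norm_T, unfolded elts_T, OF assms(3)]
        kop_closed(1)[OF norm_T, unfolded elts_T, OF assms(4)] by simp
  next
    case 3
    then show ?thesis
      using that[of u v' p q] assms(1-5) kop_closed(1)[OF norm_W assms(2)] kop_W_length[OF assms(2)] by simp
  qed
qed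

lemma whisker_eq_self: "whisker u \<gamma> v = \<gamma> \<Longrightarrow> u = [] \<and> v = []"
  by (cases \<gamma>) simp

lemma local_branchings_R:
  "(f, g) \<in> local_branchings R \<longleftrightarrow> f \<in> Step X \<and> g \<in> Step X \<and> step_source X f = step_source X g"
  by (simp add: local_branchings_def steps_R)

text \<open>Overlap and minimality of the transported branching are checked by going back. If it
  were aspherical, Peiffer or properly whiskered, the opposite operator would produce the same
  defect in (f, g).\<close>

lemma Crit_kop:
  assumes crit: "(f, g) \<in> Crit X" and f': "kop b T i f = Some f'" and g': "kop b T i g = Some g'"
  shows "(f', g') \<in> Crit X"
proof -
  have fg: "f \<in> Step X" "g \<in> Step X" "step_source X f = step_source X g"
    and ov: "overlapping X (f, g)"
    and minimal: "\<And>b'. b' \<in> local_branchings R \<Longrightarrow> branching_le X b' (f, g) \<Longrightarrow> b' = (f, g)"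
    using crit by (auto simp: Crit_def local_branchings_R)
  have fg': "f' \<in> Step X" "g' \<in> Step X"
    using kop_closed(1)[OF norm_T, unfolded elts_T] fg(1,2) f' g' by metis+
  have lowered: "kop (\<not> b) T i f' = Some f" "kop (\<not> b) T i g' = Some g"
    using kop_closed(2)[OF norm_T, unfolded elts_T] fg(1,2) f' g' by metis+
  have "step_source X f' = step_source X g'"
    using kop_source[OF fg(1), of b i] kop_source[OF fg(2), of b i] f' g' fg(3) by simp
  then have "(f', g') \<in> local_branchings R" using fg' by (simp add: local_branchings_R)
  moreover have "overlapping X (f', g')"
    using ov lowered peiffer_kop[OF _ lowered] by (auto simp: overlapping_def aspherical_def)
  moreover have "b' = (f', g')" if b': "b' \<in> local_branchings R" "branching_le X b' (f', g')" for b'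
  proof -
    obtain p q where pq: "b' = (p, q)" by (cases b')
    then have pq': "p \<in> Step X" "q \<in> Step X" "step_source X p = step_source X q"
      using b'(1) by (simp_all add: local_branchings_R)
    obtain u v where uv: "u \<in> elts W" "v \<in> elts W" "f' = whisker u p v" "g' = whisker u q v"
      using b'(2) by (auto simp: branching_le_def pq)
    obtain u1 v1 p1 q1 where w1: "u1 \<in> elts W" "v1 \<in> elts W" "p1 \<in> Step X" "q1 \<in> Step X"
      "step_source X p1 = step_source X q1" "f = whisker u1 p1 v1" "g = whisker u1 q1 v1"
      "length u1 = length u" "length v1 = length v"
      \<comment> \<open>The contexts obtained for (f, g) have the lengths of \<open>u\<close> and
        \<open>v\<close>. Minimality empties the former, hence also the latter.\<close>
      using whiskered_branching_kop[OF uv(1,2) pq' lowered[unfolded uv(3,4)]] by metis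
    have "(p1, q1) = (f, g)"
      using minimal[of "(p1, q1)"] w1 by (auto simp: local_branchings_R branching_le_def)
    then have "u1 = [] \<and> v1 = []" using whisker_eq_self[of u1 f v1] w1(6) by simp
    then have "u = []" "v = []" using w1(8,9) by auto
    then show ?thesis using uv(3,4) by (cases p, cases q) (simp add: pq)
  qed
  ultimately show ?thesis by (simp add: Crit_def)
qed

lemma critically_confluent_R: "critically_confluent X \<longleftrightarrow>
  (\<forall>f\<in>steps R. \<forall>g\<in>steps R. source R f = source R g \<longrightarrow> (f, g) \<in> Crit X \<longrightarrow>
     joinable R (target R f) (target R g))"
proof -
  have "f \<in> steps R \<and> g \<in> steps R \<and> source R f = source R g" if "(f, g) \<in> Crit X" for f g
    using that by (simp add: Crit_def local_branchings_def)
  then show ?thesis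
    unfolding critically_confluent_def using R.confluent_local_branching_iff by fastforce
qed

lemma hw_Crit_iff: "(f, g) \<in> hw_Crit X \<longleftrightarrow>
    f \<in> steps H \<and> g \<in> steps H \<and> source H f = source H g \<and> (f, g) \<in> Crit X"
  using H.source_objs[of f] H.source_objs[of g] H.target_objs[of f] H.target_objs[of g]
  by (auto simp: hw_Crit_def branchings_def finite_sequences_def)

lemma critically_confluent_H: "hw_critically_confluent X \<longleftrightarrow>
  (\<forall>f\<in>steps H. \<forall>g\<in>steps H. source H f = source H g \<longrightarrow> (f, g) \<in> Crit X \<longrightarrow>
     joinable H (target H f) (target H g))"
proof (intro iffI ballI impI)
  fix f g assume "hw_critically_confluent X"
    and fg: "f \<in> steps H" "g \<in> steps H" "source H f = source H g" "(f, g) \<in> Crit X"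
  moreover have "(f, g) \<in> hw_Crit X" using fg hw_Crit_iff by blast
  ultimately have "confluent_branching H (as_branching H (f, g))"
    unfolding hw_critically_confluent_def by blast
  then show "joinable H (target H f) (target H g)"
    using H.confluent_local_branching_iff fg(1,2) by blast
next
  assume *: "\<forall>f\<in>steps H. \<forall>g\<in>steps H. source H f = source H g \<longrightarrow> (f, g) \<in> Crit X \<longrightarrow>
    joinable H (target H f) (target H g)"
  show "hw_critically_confluent X"
    unfolding hw_critically_confluent_def
  proof
    fix b assume b: "b \<in> hw_Crit X"
    obtain f g where fg: "b = (f, g)" by (rule prod.exhaust)
    then show "confluent_branching H (as_branching H b)"
      using * b H.confluent_local_branching_iff hw_Crit_iff by blast
  qed
qed

lemma critically_confluent_iff_highest_weight:
  "critically_confluent X \<longleftrightarrow> hw_critically_confluent X"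
  unfolding critically_confluent_R critically_confluent_H
  by (rule joinable_branchings_iff) (rule Crit_kop)

end

theorem proposition3p3p4:
  fixes D :: "('i::finite, 'r::finite) cartan_datum"
    and X :: "('i, 'r, 'a, 'b) polygraph"
  assumes "kac_moody_datum D"
    and "crystal_2_polygraph D X"
  shows "(terminating (rewriting X) \<longleftrightarrow> terminating (hw_rewriting X)) \<and>
    (confluent (rewriting X) \<longleftrightarrow> confluent (hw_rewriting X)) \<and>
    (locally_confluent (rewriting X) \<longleftrightarrow> locally_confluent (hw_rewriting X)) \<and>
    (critically_confluent X \<longleftrightarrow> hw_critically_confluent X)"
proof -
  have X: "crystal D (gen1 X)" "crystal D (gen2 X)"
    "crystal_morphism (gen2 X) (words (gen1 X)) (src1 X)"
    "crystal_morphism (gen2 X) (words (gen1 X)) (tgt1 X)"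
    using assms(2) by (simp_all add: crystal_2_polygraph_def)
  have norm: "normal_strings (gen1 X)" "normal_strings (gen2 X)"
    using X(1,2) normal_crystal_strings by (auto simp: crystal_def)
  \<comment> \<open>Here the module theory and the independence of the simple roots enter.\<close>
  obtain d :: "'a \<Rightarrow> nat"
    where "\<And>x y i. x \<in> elts (gen1 X) \<Longrightarrow> ke (gen1 X) i x = Some y \<Longrightarrow> d y < d x"
    using depth_function[OF assms(1) X(1)] by blast
  then interpret polygraph_with_strings X d
    by unfold_locales (use norm X in auto)
  show ?thesis
    using terminating_iff confluent_iff_highest_weight locally_confluent_iff_highest_weight
      critically_confluent_iff_highest_weight by simp
qed

end
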